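(* Let $(X,Y)$ be a random vector in $\mathbb{R}^{d_x}\times\mathbb{R}^{d_y}$ with law $\nu$, $\mathbb{E}[\|X\|^2+\|Y\|^2]<\infty$ and $\mathbb{E}[X]=0$; let $\mu$ be a Borel probability measure on $\mathbb{R}^{d_y}$ with finite second moment, and let $\varepsilon>0$. If $$\mathbb{E}\big[e^{\alpha'\|X\|}\big]<\infty\quad\text{for all }\alpha'>0,$$ then the mapping $Q\mapsto\mathsf{KL}(Q\,\|\,\tilde R)$ is coercive in $\tilde{\mathsf W}_1$, i.e. for every $0<a<\infty$ the sublevel set $\{Q\in\tilde{\mathcal P}_1:\mathsf{KL}(Q\,\|\,\tilde R)\le a\}$ is compact for the $\tilde{\mathsf W}_1$-topology.
   Context: Points of $\mathbb{R}^{d_y}\times\mathbb{R}^{d_x+d_y}$ are written $(u,x,y)$; $c(u,y):=\frac12\|u-y\|^2$; $R:=\mu\otimes\nu$. $\tilde R$ is the probability measure $d\tilde R:=\alpha^{-1}e^{-c/\varepsilon}\,dR$ with $\alpha:=\int e^{-c/\varepsilon}\,dR\in(0,\infty)$. $\mathsf{KL}(P\|Q)=\int\log\frac{dP}{dQ}\,dP$ if $P\ll Q$ and $\infty$ otherwise. The metric $\tilde{\mathsf d}$ on $\mathbb{R}^{d_y}\times\mathbb{R}^{d_x+d_y}$ is $\tilde{\mathsf d}((u,x,y),(u',x',y')):=\min\{\|u-u'\|,1\}+\|x-x'\|+\min\{\|y-y'\|,1\}$; $\tilde{\mathcal P}_1$ is the set of Borel probability measures $P$ on this space with $\int\tilde{\mathsf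 d}(\cdot,0)\,dP<\infty$; $\tilde{\mathsf W}_1(P,Q):=\inf_{\gamma\in\Pi(P,Q)}\int\tilde{\mathsf d}\,d\gamma$ (infimum over couplings of $P$ and $Q$) is the corresponding $1$-Wasserstein metric on $\tilde{\mathcal P}_1$. *)

theory Defs
  imports "HOL-Probability.Probability"
begin

type_synonym ('dx, 'dy) pt = "(real ^ 'dy) \<times> (real ^ 'dx) \<times> (real ^ 'dy)"

definition cost :: "real ^ 'dy \<Rightarrow> real ^ 'dy \<Rightarrow> real" where
  "cost u y = (norm (u - y))\<^sup>2 / 2"

definition gibbs_mass ::
    "real \<Rightarrow> (real ^ 'dy) measure \<Rightarrow> ((real ^ 'dx) \<times> (real ^ 'dy)) measure \<Rightarrow> real" where
  "gibbs_mass \<epsilon> \<mu> \<nu> = (\<integral>(u, x, y). exp (- cost u y / \<epsilon>) \<partial>(\<mu> \<Otimes>\<^sub>M \<nu>))"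

definition gibbs_measure ::
    "real \<Rightarrow> (real ^ 'dy) measure \<Rightarrow> ((real ^ 'dx) \<times> (real ^ 'dy)) measure
      \<Rightarrow> ('dx::finite, 'dy::finite) pt measure" where
  "gibbs_measure \<epsilon> \<mu> \<nu> =
     density (\<mu> \<Otimes>\<^sub>M \<nu>)
       (\<lambda>(u, x, y). ennreal (inverse (gibbs_mass \<epsilon> \<mu> \<nu>) * exp (- cost u y / \<epsilon>)))"

text \<open>
  The library's \<^const>\<open>KL_divergence\<close> is real-valued and takes the reference measure first;
  moreover a Bochner integral that does not converge is \<open>0\<close>. For probability measures
  with \<open>P \<lless> Q\<close> the negative part of \<open>ln (dP/dQ)\<close> is always \<open>P\<close>-integrable, so that
  non-integrability means that \<open>\<integral> ln (dP/dQ) dP\<close> is \<open>\<infinity>\<close>; see \<open>KL_eq_extended_integral\<close>.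
\<close>

definition KL :: "'a measure \<Rightarrow> 'a measure \<Rightarrow> ereal" where
  "KL P Q =
     (if absolutely_continuous Q P \<and> integrable P (entropy_density (exp 1) Q P)
      then ereal (KL_divergence (exp 1) Q P) else \<infinity>)"

lemma nn_integral_neg_entropy_density_finite:
  assumes "prob_space P" "prob_space Q" "sets P = sets Q" "absolutely_continuous Q P"
  shows "(\<integral>\<^sup>+ z. ennreal (- entropy_density (exp 1) Q P z) \<partial>P) \<le> 1"
proof -
  interpret P: prob_space P by fact
  interpret Q: prob_space Q by fact
  let ?f = "RN_deriv Q P"
  have d: "density Q ?f = P"
    using Q.density_RN_deriv assms by metis
  have le: "?f z * ennreal (- ln (enn2real (?f z))) \<le> 1" if "?f z \<noteq> \<infinity>" for z
  proof -
    define t where "t = enn2real (?f z)"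
    have t: "t \<ge> 0" "?f z = ennreal t"
      using that by (auto simp: t_def top.not_eq_extremum)
    have "t * (- ln t) \<le> 1"
    proof (cases "t = 0")
      case False
      then have "t > 0" using t by simp
      then have "- ln t \<le> inverse t - 1"
        using ln_le_minus_one[of "inverse t"] by (simp add: ln_inverse)
      then have "t * (- ln t) \<le> t * (inverse t - 1)"
        using \<open>t > 0\<close> by (intro mult_left_mono) auto
      then show ?thesis using \<open>t > 0\<close> by (simp add: algebra_simps)
    qed simp
    then show ?thesis
      using t by (simp add: t_def [symmetric] ennreal_mult' [symmetric])
  qed
  have fin: "AE z in Q. ?f z \<noteq> \<infinity>"
    using Q.RN_deriv_finite[of P] assms P.sigma_finite_measure_axioms by auto
  have "(\<integral>\<^sup>+ z. ennreal (- entropy_density (exp 1) Q P z) \<partial>P)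
      = (\<integral>\<^sup>+ z. ennreal (- entropy_density (exp 1) Q P z) \<partial>density Q ?f)"
    by (simp add: d)
  also have "\<dots> = (\<integral>\<^sup>+ z. ?f z * ennreal (- entropy_density (exp 1) Q P z) \<partial>Q)"
    by (intro nn_integral_density) auto
  also have "\<dots> \<le> (\<integral>\<^sup>+ z. 1 \<partial>Q)"
  proof (rule nn_integral_mono_AE)
    show "AE z in Q. ?f z * ennreal (- entropy_density (exp 1) Q P z) \<le> 1"
      using fin
    proof (rule AE_mp)
      show "AE z in Q. ?f z \<noteq> \<infinity> \<longrightarrow> ?f z * ennreal (- entropy_density (exp 1) Q P z) \<le> 1"
        using le by (intro AE_I2 impI) (simp add: entropy_density_def log_def)
    qed
  qed
  finally show ?thesis by (simp add: Q.emeasure_space_1)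
qed

lemma KL_eq_extended_integral:
  assumes "prob_space P" "prob_space Q" "sets P = sets Q" "absolutely_continuous Q P"
  shows "KL P Q = enn2ereal (\<integral>\<^sup>+ z. ennreal (ln (enn2real (RN_deriv Q P z))) \<partial>P)
                - enn2ereal (\<integral>\<^sup>+ z. ennreal (- ln (enn2real (RN_deriv Q P z))) \<partial>P)"
proof -
  let ?g = "entropy_density (exp 1) Q P"
  have g: "?g = (\<lambda>z. ln (enn2real (RN_deriv Q P z)))"
    by (auto simp: entropy_density_def log_def fun_eq_iff)
  have [measurable]: "?g \<in> borel_measurable P"
    using measurable_entropy_density[of "exp 1" Q P] assms(3) by (simp cong: measurable_cong_sets)
  have neg: "(\<integral>\<^sup>+ z. ennreal (- ?g z) \<partial>P) < \<infinity>"
    using nn_integral_neg_entropy_density_finite[OF assms] by (auto simp: le_less_trans)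
  show ?thesis
  proof (cases "integrable P ?g")
    case True
    then have pos: "(\<integral>\<^sup>+ z. ennreal (?g z) \<partial>P) < \<infinity>"
      by (auto simp: real_integrable_def top.not_eq_extremum)
    have "enn2ereal a = ereal (enn2real a)" if "a < \<infinity>" for a :: ennreal
      using that by (cases a) auto
    with pos neg have "enn2ereal (\<integral>\<^sup>+ z. ennreal (?g z) \<partial>P) - enn2ereal (\<integral>\<^sup>+ z. ennreal (- ?g z) \<partial>P)
        = ereal (integral\<^sup>L P ?g)"
      by (simp add: real_lebesgue_integral_def[OF True])
    then show ?thesis
      using True assms(4) by (simp add: KL_def KL_divergence_def g)
  next
    case False
    then have "(\<integral>\<^sup>+ z. ennreal (?g z) \<partial>P) = \<infinity>"
      using neg by (auto simp: real_integrable_def)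
    then show ?thesis
      using False neg by (cases "\<integral>\<^sup>+ z. ennreal (- ?g z) \<partial>P") (auto simp: KL_def g)
  qed
qed

definition dtilde :: "('dx::finite, 'dy::finite) pt \<Rightarrow> ('dx, 'dy) pt \<Rightarrow> real" where
  "dtilde = (\<lambda>(u, x, y) (u', x', y').
     min (norm (u - u')) 1 + norm (x - x') + min (norm (y - y')) 1)"

definition P1tilde :: "('dx::finite, 'dy::finite) pt measure set" where
  "P1tilde = {P. prob_space P \<and> sets P = sets borel \<and> (\<integral>\<^sup>+ z. ennreal (dtilde z 0) \<partial>P) < \<infinity>}"

definition couplings ::
    "'a::topological_space measure \<Rightarrow> 'a measure \<Rightarrow> ('a \<times> 'a) measure set" where
  "couplings P Q =
     {\<gamma>. prob_space \<gamma> \<and> sets \<gamma> = sets borel \<and> distr \<gamma> borel fst = P \<and> distr \<gamma> borel snd = Q}"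

text \<open>The infimum is finite on \<^const>\<open>P1tilde\<close>, where the passage to \<^typ>\<open>real\<close> is lossless.\<close>

definition W1tilde :: "('dx::finite, 'dy::finite) pt measure \<Rightarrow> ('dx, 'dy) pt measure \<Rightarrow> real" where
  "W1tilde P Q = enn2real (INF \<gamma>\<in>couplings P Q. \<integral>\<^sup>+ (z, z'). ennreal (dtilde z z') \<partial>\<gamma>)"

abbreviation W1tilde_topology :: "('dx::finite, 'dy::finite) pt measure topology" where
  "W1tilde_topology \<equiv> Metric_space.mtopology P1tilde W1tilde"

end

theory Submission
  imports Defs
begin

text \<open>
  Write \<open>R\<close> for the Gibbs measure. Its density with respect to \<open>\<mu> \<Otimes> \<nu>\<close> is bounded, so that
  \<open>exp (\<alpha> * norm x)\<close> is \<open>R\<close>-integrable for every \<open>\<alpha>\<close>. The sublevel sets are compact for every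
  Borel probability measure \<open>R\<close> with this property (\<open>KL_sublevel_compactin\<close>).

  The main tool is \<open>entropy_inequality\<close>: if \<open>KL Q R \<le> a\<close>, then
  \<open>\<integral> \<phi> dQ \<le> a + \<integral> exp \<phi> dR - 1\<close>. Applied to a large multiple of an indicator function it
  shows that the measures of the sublevel set are uniformly absolutely continuous with respect to \<open>R\<close>,
  and applied to \<open>\<alpha> * (2 + norm x)\<close>, cut off to a set of small mass, that \<open>norm x\<close> is uniformly
  integrable over the sublevel set. Conversely, if \<open>Q\<close> is absolutely
  continuous with respect to \<open>R\<close>, the inequality for all bounded \<open>\<phi>\<close> implies \<open>KL Q R \<le> a\<close>
  (\<open>KL_leI\<close>).

  A sequence in the sublevel set therefore has a subsequence that converges on every Borel set to
  a probability measure \<open>q\<close> (\<open>setwise_convergent_subsequence\<close>): a diagonal argument on a countable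
  generator gives limits, which uniform absolute continuity extends to all Borel sets and makes
  countably additive. Tightness and Prokhorov's theorem are not needed. Since the
  integrals of bounded functions converge, \<open>q\<close> inherits the entropy inequality and so lies in the
  sublevel set (\<open>KL_le_setwise_limit\<close>).

  Setwise convergence gives convergence in the transport distance
  (\<open>setwise_tendsto_W1tilde\<close>): cut the space into finitely many cells of small diameter and one
  remaining cell on which \<open>2 + norm x\<close> has a small integral uniformly over the sublevel set. The
  masses of the cells converge, and a maximal coupling of the mass vectors lifts to a coupling of
  the measures with small transport cost.

  Finally, sequential compactness is compactness because \<^const>\<open>W1tilde\<close> is a metric on
  \<^const>\<open>P1tilde\<close> (\<open>Metric_space_W1tilde\<close>). The triangle inequality is proved without
  disintegration, by gluing couplings along a partition into small cells.
\<close>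

section \<open>The truncated metric on the product space\<close>

lemma dtilde_alt:
  "dtilde z w = min (norm (fst z - fst w)) 1 + norm (fst (snd z) - fst (snd w))
     + min (norm (snd (snd z) - snd (snd w))) 1"
  by (cases z; cases w) (simp add: dtilde_def)

lemma dtilde_nonneg [simp]: "0 \<le> dtilde z w"
  by (simp add: dtilde_alt)

lemma dtilde_self [simp]: "dtilde z z = 0"
  by (simp add: dtilde_alt)

lemma dtilde_commute: "dtilde z w = dtilde w z"
  by (simp add: dtilde_alt norm_minus_commute)

lemma min_norm_triangle:
  fixes a b c :: "'a::real_normed_vector"
  shows "min (norm (a - c)) 1 \<le> min (norm (a - b)) 1 + min (norm (b - c)) 1"
  using norm_triangle_ineq[of "a - b" "b - c"] norm_ge_zero[of "a - b"] norm_ge_zero[of "b - c"]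
  by (simp add: min_def del: norm_ge_zero)

lemma dtilde_triangle: "dtilde x z \<le> dtilde x y + dtilde y z"
proof -
  have "norm (fst (snd x) - fst (snd z)) \<le>
      norm (fst (snd x) - fst (snd y)) + norm (fst (snd y) - fst (snd z))"
    using norm_triangle_ineq[of "fst (snd x) - fst (snd y)" "fst (snd y) - fst (snd z)"] by simp
  then show ?thesis
    unfolding dtilde_alt
    using min_norm_triangle[of "fst x" "fst z" "fst y"]
      min_norm_triangle[of "snd (snd x)" "snd (snd z)" "snd (snd y)"] by linarith
qed

lemma borel_measurable_dtilde [measurable]:
  fixes f g :: "'a \<Rightarrow> ('dx::finite, 'dy::finite) pt"
  assumes "f \<in> borel_measurable M" "g \<in> borel_measurable M"
  shows "(\<lambda>x. dtilde (f x) (g x)) \<in> borel_measurable M"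
proof -
  have "continuous_on UNIV (\<lambda>p::('dx, 'dy) pt \<times> ('dx, 'dy) pt. dtilde (fst p) (snd p))"
    unfolding dtilde_alt by (intro continuous_intros)
  then have "(\<lambda>p::('dx, 'dy) pt \<times> ('dx, 'dy) pt. dtilde (fst p) (snd p)) \<in> borel_measurable borel"
    by (rule borel_measurable_continuous_onI)
  from measurable_compose[OF borel_measurable_Pair[OF assms] this] show ?thesis
    by simp
qed

lemma dtilde_le_dist: "dtilde z w \<le> 3 * dist z w"
proof -
  have "norm (fst z - fst w) \<le> dist z w" "norm (fst (snd z) - fst (snd w)) \<le> dist z w"
     "norm (snd (snd z) - snd (snd w)) \<le> dist z w"
    using dist_fst_le[of z w] dist_snd_le[of z w] dist_fst_le[of "snd z" "snd w"]
      dist_snd_le[of "snd z" "snd w"]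
    by (auto simp: dist_norm)
  then show ?thesis unfolding dtilde_alt by linarith
qed

lemma min_dist_le_dtilde: "min (dist z w) 1 \<le> dtilde z w"
proof -
  have "dist z w \<le> norm (fst z - fst w) + norm (snd z - snd w)"
    using norm_Pair_le[of "fst z - fst w" "snd z - snd w"] by (cases z; cases w) (simp add: dist_norm)
  also have "norm (snd z - snd w) \<le> norm (fst (snd z) - fst (snd w)) + norm (snd (snd z) - snd (snd w))"
    using norm_Pair_le[of "fst (snd z) - fst (snd w)" "snd (snd z) - snd (snd w)"]
    by (cases "snd z"; cases "snd w") simp
  finally show ?thesis
    unfolding dtilde_alt using norm_ge_zero[of "fst z - fst w"] 
     norm_ge_zero[of "fst (snd z) - fst (snd w)"] norm_ge_zero[of "snd (snd z) - snd (snd w)"]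
    unfolding min_def by (auto simp del: norm_ge_zero)
qed

lemma dtilde_0_le: "dtilde z 0 \<le> 2 + norm (fst (snd z))"
  unfolding dtilde_alt by (simp add: zero_prod_def)

text \<open>
  A countable measurable partition into cells of small diameter: \<open>c z\<close> is the index of the cell
  of \<open>z\<close>, and \<open>s i\<close> is a reference point near the cell \<open>i\<close>.
\<close>

lemma ex_small_cells:
  assumes "\<delta> > 0"
  obtains c :: "('dx::finite, 'dy::finite) pt \<Rightarrow> nat" and s :: "nat \<Rightarrow> ('dx, 'dy) pt"
  where "c \<in> borel \<rightarrow>\<^sub>M count_space UNIV" "\<And>z. dtilde z (s (c z)) \<le> \<delta>"
proof -
  obtain D :: "('dx, 'dy) pt set" where D: "countable D" "\<And>X. open X \<Longrightarrow> X \<noteq> {} \<Longrightarrow> \<exists>d\<in>D. d \<in> X"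
    using countable_dense_setE by blast
  have "D \<noteq> {}" using D(2)[of UNIV] by auto
  define s where "s = from_nat_into D"
  define c where "c z = (LEAST i. dist z (s i) < \<delta> / 3)" for z
  have ex: "\<exists>i. dist z (s i) < \<delta> / 3" for z
  proof -
    obtain d where "d \<in> D" "d \<in> ball z (\<delta> / 3)"
      using D(2)[of "ball z (\<delta>/3)"] assms by auto
    then show ?thesis
      using from_nat_into_surj[OF D(1)] unfolding s_def by (metis mem_ball)
  qed
  have "dist z (s (c z)) < \<delta> / 3" for z
    unfolding c_def using ex by (rule LeastI_ex)
  then have "3 * dist z (s (c z)) \<le> \<delta>" for z
    by (simp add: field_simps less_imp_le)
  then have "dtilde z (s (c z)) \<le> \<delta>" for z
    using dtilde_le_dist order_trans by blast
  moreover have "c \<in> borel \<rightarrow>\<^sub>M count_space UNIV"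
    unfolding c_def by measurable
  ultimately show ?thesis using that by blast
qed

section \<open>Couplings\<close>

text \<open>
  The infimum behind \<^const>\<open>W1tilde\<close>, kept as an extended nonnegative real: the coupling
  arguments below then need no finiteness assumptions.
\<close>

definition transport_cost ::
    "('dx::finite, 'dy::finite) pt measure \<Rightarrow> ('dx, 'dy) pt measure \<Rightarrow> ennreal" where
  "transport_cost P Q = (INF \<gamma>\<in>couplings P Q. \<integral>\<^sup>+ (z, z'). ennreal (dtilde z z') \<partial>\<gamma>)"

lemma W1tilde_eq: "W1tilde P Q = enn2real (transport_cost P Q)"
  by (simp add: W1tilde_def transport_cost_def)

lemma transport_cost_less:
  "transport_cost P Q < C \<Longrightarrow>
    \<exists>\<gamma>\<in>couplings P Q. (\<integral>\<^sup>+ (z, z'). ennreal (dtilde z z') \<partial>\<gamma>) < C"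
  by (simp add: transport_cost_def INF_less_iff)

lemma borel_measurable_fst_prod [measurable]:
  "fst \<in> borel_measurable (borel :: ('a::topological_space \<times> 'b::topological_space) measure)"
  by (intro borel_measurable_continuous_onI continuous_intros)

lemma borel_measurable_snd_prod [measurable]:
  "snd \<in> borel_measurable (borel :: ('a::topological_space \<times> 'b::topological_space) measure)"
  by (intro borel_measurable_continuous_onI continuous_intros)

lemma distr_couplings:
  fixes f g :: "'a \<Rightarrow> 'b::second_countable_topology"
  assumes "prob_space N" and [measurable]: "f \<in> borel_measurable N" "g \<in> borel_measurable N"
  shows "distr N borel (\<lambda>w. (f w, g w)) \<in> couplings (distr N borel f) (distr N borel g)"
  using assms
  by (auto simp: couplings_def distr_distr comp_def intro!: prob_space.prob_space_distr)

lemma transport_cost_le: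
  fixes f g :: "'a \<Rightarrow> ('dx::finite, 'dy::finite) pt"
  assumes "prob_space N" and [measurable]: "f \<in> borel_measurable N" "g \<in> borel_measurable N"
  shows "transport_cost (distr N borel f) (distr N borel g) \<le> (\<integral>\<^sup>+ w. ennreal (dtilde (f w) (g w)) \<partial>N)"
proof -
  have "transport_cost (distr N borel f) (distr N borel g)
      \<le> (\<integral>\<^sup>+ (z, z'). ennreal (dtilde z z') \<partial>distr N borel (\<lambda>w. (f w, g w)))"
    unfolding transport_cost_def by (intro INF_lower distr_couplings assms)
  also have "\<dots> = (\<integral>\<^sup>+ w. ennreal (dtilde (f w) (g w)) \<partial>N)"
    unfolding case_prod_beta' by (subst nn_integral_distr) auto
  finally show ?thesis .
qed

lemma couplingsD:
  fixes P Q :: "'a::second_countable_topology measure"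
  assumes "\<gamma> \<in> couplings P Q"
  shows "prob_space \<gamma>" "sets \<gamma> = sets borel" "distr \<gamma> borel fst = P" "distr \<gamma> borel snd = Q"
    "fst \<in> borel_measurable \<gamma>" "snd \<in> borel_measurable \<gamma>"
    "g \<in> borel_measurable borel \<Longrightarrow> (\<integral>\<^sup>+ w. g (fst w) \<partial>\<gamma>) = (\<integral>\<^sup>+ z. g z \<partial>P)"
    "g \<in> borel_measurable borel \<Longrightarrow> (\<integral>\<^sup>+ w. g (snd w) \<partial>\<gamma>) = (\<integral>\<^sup>+ z. g z \<partial>Q)"
proof -
  show *: "prob_space \<gamma>" "sets \<gamma> = sets borel" and P: "distr \<gamma> borel fst = P"
    and Q: "distr \<gamma> borel snd = Q"
    using assms by (auto simp: couplings_def)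
  from * show m [measurable]: "fst \<in> borel_measurable \<gamma>" "snd \<in> borel_measurable \<gamma>"
    by (simp_all cong: measurable_cong_sets)
  show "(\<integral>\<^sup>+ w. g (fst w) \<partial>\<gamma>) = (\<integral>\<^sup>+ z. g z \<partial>P)" if "g \<in> borel_measurable borel"
    unfolding P[symmetric] using that by (subst nn_integral_distr) auto
  show "(\<integral>\<^sup>+ w. g (snd w) \<partial>\<gamma>) = (\<integral>\<^sup>+ z. g z \<partial>Q)" if "g \<in> borel_measurable borel"
    unfolding Q[symmetric] using that by (subst nn_integral_distr) auto
qed

text \<open>
  The couplings constructed below are densities with respect to a product measure; the marginals
  are correct as soon as both partial integrals of the density are \<open>1\<close>.
\<close>

lemma nn_integral_density_marginals:
  assumes "prob_space A" "prob_space B"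
    and [measurable]: "k \<in> borel_measurable (A \<Otimes>\<^sub>M B)"
    and 1: "AE a in A. (\<integral>\<^sup>+ b. k (a, b) \<partial>B) = 1"
    and 2: "AE b in B. (\<integral>\<^sup>+ a. k (a, b) \<partial>A) = 1"
  shows "g \<in> borel_measurable A \<Longrightarrow> (\<integral>\<^sup>+ w. g (fst w) \<partial>density (A \<Otimes>\<^sub>M B) k) = (\<integral>\<^sup>+ a. g a \<partial>A)"
    and "h \<in> borel_measurable B \<Longrightarrow> (\<integral>\<^sup>+ w. h (snd w) \<partial>density (A \<Otimes>\<^sub>M B) k) = (\<integral>\<^sup>+ b. h b \<partial>B)"
    and "prob_space (density (A \<Otimes>\<^sub>M B) k)"
proof -
  interpret A: prob_space A by fact
  interpret B: prob_space B by fact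
  interpret pair_prob_space A B ..
  show *: "(\<integral>\<^sup>+ w. g (fst w) \<partial>density (A \<Otimes>\<^sub>M B) k) = (\<integral>\<^sup>+ a. g a \<partial>A)"
    if [measurable]: "g \<in> borel_measurable A" for g
  proof -
    have "(\<integral>\<^sup>+ w. g (fst w) \<partial>density (A \<Otimes>\<^sub>M B) k) = (\<integral>\<^sup>+ w. k w * g (fst w) \<partial>(A \<Otimes>\<^sub>M B))"
      by (rule nn_integral_density) auto
    also have "\<dots> = (\<integral>\<^sup>+ a. \<integral>\<^sup>+ b. k (a, b) * g a \<partial>B \<partial>A)"
      by (subst B.nn_integral_fst[symmetric]) auto
    also have "\<dots> = (\<integral>\<^sup>+ a. (\<integral>\<^sup>+ b. k (a, b) \<partial>B) * g a \<partial>A)"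
      by (intro nn_integral_cong nn_integral_multc) auto
    also have "\<dots> = (\<integral>\<^sup>+ a. g a \<partial>A)"
      using 1 by (intro nn_integral_cong_AE) auto
    finally show ?thesis .
  qed
  show "(\<integral>\<^sup>+ w. h (snd w) \<partial>density (A \<Otimes>\<^sub>M B) k) = (\<integral>\<^sup>+ b. h b \<partial>B)"
    if [measurable]: "h \<in> borel_measurable B"
  proof -
    have "(\<integral>\<^sup>+ w. h (snd w) \<partial>density (A \<Otimes>\<^sub>M B) k) = (\<integral>\<^sup>+ w. k w * h (snd w) \<partial>(A \<Otimes>\<^sub>M B))"
      by (rule nn_integral_density) auto
    also have "\<dots> = (\<integral>\<^sup>+ b. \<integral>\<^sup>+ a. k (a, b) * h b \<partial>A \<partial>B)"
      by (subst nn_integral_snd[symmetric]) auto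
    also have "\<dots> = (\<integral>\<^sup>+ b. (\<integral>\<^sup>+ a. k (a, b) \<partial>A) * h b \<partial>B)"
      by (intro nn_integral_cong nn_integral_multc) auto
    also have "\<dots> = (\<integral>\<^sup>+ b. h b \<partial>B)"
      using 2 by (intro nn_integral_cong_AE) auto
    finally show ?thesis .
  qed
  show "prob_space (density (A \<Otimes>\<^sub>M B) k)"
    using *[of "\<lambda>_. 1"] by (intro prob_spaceI) (simp add: A.emeasure_space_1)
qed

lemma distr_eqI_nn_integral:
  assumes "sets P = sets M" "f \<in> N \<rightarrow>\<^sub>M M"
    and "\<And>g. g \<in> borel_measurable P \<Longrightarrow> (\<integral>\<^sup>+ w. g (f w) \<partial>N) = (\<integral>\<^sup>+ z. g z \<partial>P)"
  shows "distr N M f = P"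
proof (rule measure_eqI)
  fix A assume "A \<in> sets (distr N M f)"
  then have A: "A \<in> sets M" "A \<in> sets P" using assms(1) by auto
  have "emeasure (distr N M f) A = (\<integral>\<^sup>+ w. indicator A (f w) \<partial>N)"
    using A assms(2) by (simp add: nn_integral_distr flip: nn_integral_indicator)
  also have "\<dots> = emeasure P A"
    using A assms(3)[of "indicator A"] by simp
  finally show "emeasure (distr N M f) A = emeasure P A" .
qed (use assms in auto)

lemma AE_cell_nonnull:
  assumes "sets Q = sets M" "c \<in> M \<rightarrow>\<^sub>M count_space (UNIV :: nat set)"
  shows "AE y in Q. emeasure Q {z \<in> space M. c z = c y} \<noteq> 0"
proof -
  have [measurable]: "c \<in> Q \<rightarrow>\<^sub>M count_space UNIV"
    using assms by (simp cong: measurable_cong_sets)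
  have sp: "space Q = space M" using assms(1) by (rule sets_eq_imp_space_eq)
  have "AE y in Q. \<forall>i. emeasure Q {z \<in> space Q. c z = i} = 0 \<longrightarrow> c y \<noteq> i"
    unfolding AE_all_countable
  proof (intro allI)
    fix i
    show "AE y in Q. emeasure Q {z \<in> space Q. c z = i} = 0 \<longrightarrow> c y \<noteq> i"
    proof (cases "emeasure Q {z \<in> space Q. c z = i} = 0")
      case True
      then show ?thesis
        by (intro AE_I[of _ _ "{z \<in> space Q. c z = i}"]) auto
    qed auto
  qed
  then show ?thesis unfolding sp by (rule AE_mp) (auto intro!: AE_I2)
qed

text \<open>
  The triangle inequality needs a joint law of three points with prescribed pair laws
  \<open>\<gamma>1\<close> and \<open>\<gamma>2\<close>. Disintegration is avoided by gluing only approximately: the middle points of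
  \<open>\<gamma>1\<close> and \<open>\<gamma>2\<close> are made independent conditionally on lying in the same small cell, which costs
  at most the diameter of a cell.
\<close>

lemma glue_couplings:
  fixes P Q R :: "('dx::finite, 'dy::finite) pt measure"
  assumes \<gamma>1: "\<gamma>1 \<in> couplings P Q" and \<gamma>2: "\<gamma>2 \<in> couplings Q R" and "\<delta> > 0"
  shows "transport_cost P R \<le> (\<integral>\<^sup>+ (z, z'). ennreal (dtilde z z') \<partial>\<gamma>1)
    + (\<integral>\<^sup>+ (z, z'). ennreal (dtilde z z') \<partial>\<gamma>2) + ennreal \<delta>"
proof -
  note 1 = couplingsD[OF \<gamma>1] and 2 = couplingsD[OF \<gamma>2]
  note [measurable] = 1(5,6) 2(5,6)
  have [measurable_cong]: "sets \<gamma>1 = sets (borel \<Otimes>\<^sub>M borel)" "sets \<gamma>2 = sets (borel \<Otimes>\<^sub>M borel)"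
    by (subst borel_prod, rule 1 2)+
  interpret \<gamma>1: prob_space \<gamma>1 by fact
  interpret \<gamma>2: prob_space \<gamma>2 by fact
  have Q: "sets Q = sets borel" "prob_space Q"
    using 1(4) by (auto intro!: \<gamma>1.prob_space_distr simp flip: 1(4))
  interpret Q: prob_space Q by fact
  have [measurable_cong]: "sets Q = sets borel" by fact
  have sQ: "space Q = UNIV" using sets_eq_imp_space_eq[OF Q(1)] by simp
  obtain c :: "('dx, 'dy) pt \<Rightarrow> nat" and s where
    c [measurable]: "c \<in> borel \<rightarrow>\<^sub>M count_space UNIV" and s: "\<And>z. dtilde z (s (c z)) \<le> \<delta> / 2"
    using ex_small_cells[of "\<delta> / 2"] \<open>\<delta> > 0\<close> by auto
  define m where "m i = emeasure Q {z. c z = i}" for i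
  \<comment> \<open>The two middle points are \<open>snd (fst w)\<close> and \<open>fst (snd w)\<close>; \<open>m i\<close> is the mass of cell \<open>i\<close>.\<close>
  define k where "k w = (if c (snd (fst w)) = c (fst (snd w)) then inverse (m (c (snd (fst w)))) else 0)"
    for w :: "(('dx, 'dy) pt \<times> ('dx, 'dy) pt) \<times> (('dx, 'dy) pt \<times> ('dx, 'dy) pt)"
  have [measurable]: "(\<lambda>z. inverse (m (c z))) \<in> borel_measurable borel"
    by (rule measurable_compose[OF c]) simp
  have k [measurable]: "k \<in> borel_measurable (\<gamma>1 \<Otimes>\<^sub>M \<gamma>2)"
  proof -
    have [measurable]: "(\<lambda>w. c (snd (fst w))) \<in> \<gamma>1 \<Otimes>\<^sub>M \<gamma>2 \<rightarrow>\<^sub>M count_space UNIV"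
      "(\<lambda>w. c (fst (snd w))) \<in> \<gamma>1 \<Otimes>\<^sub>M \<gamma>2 \<rightarrow>\<^sub>M count_space UNIV"
      by (rule measurable_compose[OF _ c], measurable)+
    have m: "(\<lambda>w. inverse (m (c (snd (fst w))))) \<in> borel_measurable (\<gamma>1 \<Otimes>\<^sub>M \<gamma>2)"
      by (rule measurable_compose[where N = "count_space UNIV"]) auto
    have "{w \<in> space (\<gamma>1 \<Otimes>\<^sub>M \<gamma>2). c (snd (fst w)) = c (fst (snd w))}
        = {w \<in> space (\<gamma>1 \<Otimes>\<^sub>M \<gamma>2). \<exists>i. c (snd (fst w)) = i \<and> c (fst (snd w)) = i}"
      by auto
    also have "\<dots> \<in> sets (\<gamma>1 \<Otimes>\<^sub>M \<gamma>2)"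
      by measurable
    finally show ?thesis
      unfolding k_def using m by (intro measurable_If) simp_all
  qed
  have null: "AE y in Q. m (c y) \<noteq> 0"
    using AE_cell_nonnull[OF Q(1) c] by (simp add: m_def)
  have int: "(\<integral>\<^sup>+ y. (if c y = i then inverse (m i) else 0) \<partial>Q) = 1" if "m i \<noteq> 0" for i
  proof -
    have "(\<integral>\<^sup>+ y. (if c y = i then inverse (m i) else 0) \<partial>Q)
        = (\<integral>\<^sup>+ y. inverse (m i) * indicator {z. c z = i} y \<partial>Q)"
      by (intro nn_integral_cong) auto
    also have "\<dots> = inverse (m i) * m i"
      by (subst nn_integral_cmult_indicator) (auto simp: m_def sQ)
    also have "\<dots> = 1"
    proof -
      have "m i < top"
        by (simp add: m_def less_top[symmetric])
      then show ?thesis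
        using that ennreal_divide_self[of "m i"] by (simp add: divide_ennreal_def mult.commute)
    qed
    finally show ?thesis .
  qed
  have k1: "AE v in \<gamma>1. (\<integral>\<^sup>+ w. k (v, w) \<partial>\<gamma>2) = 1"
  proof -
    have "AE v in \<gamma>1. m (c (snd v)) \<noteq> 0"
      using null unfolding 1(4)[symmetric] by (subst (asm) AE_distr_iff) auto
    then show ?thesis
    proof (rule AE_mp, intro AE_I2 impI)
      fix v :: "('dx, 'dy) pt \<times> ('dx, 'dy) pt" assume *: "m (c (snd v)) \<noteq> 0"
      have "(\<integral>\<^sup>+ w. k (v, w) \<partial>\<gamma>2) = (\<integral>\<^sup>+ y. (if c y = c (snd v) then inverse (m (c (snd v))) else 0) \<partial>Q)"
        unfolding k_def by (subst 2(7)[symmetric]) (auto intro!: nn_integral_cong)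
      then show "(\<integral>\<^sup>+ w. k (v, w) \<partial>\<gamma>2) = 1" using int[OF *] by simp
    qed
  qed
  have k2: "AE w in \<gamma>2. (\<integral>\<^sup>+ v. k (v, w) \<partial>\<gamma>1) = 1"
  proof -
    have "AE w in \<gamma>2. m (c (fst w)) \<noteq> 0"
      using null unfolding 2(3)[symmetric] by (subst (asm) AE_distr_iff) auto
    then show ?thesis
    proof (rule AE_mp, intro AE_I2 impI)
      fix w :: "('dx, 'dy) pt \<times> ('dx, 'dy) pt" assume *: "m (c (fst w)) \<noteq> 0"
      have "(\<integral>\<^sup>+ v. k (v, w) \<partial>\<gamma>1) = (\<integral>\<^sup>+ y. (if c y = c (fst w) then inverse (m (c (fst w))) else 0) \<partial>Q)"
        unfolding k_def by (subst 1(8)[symmetric]) (auto intro!: nn_integral_cong)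
      then show "(\<integral>\<^sup>+ v. k (v, w) \<partial>\<gamma>1) = 1" using int[OF *] by simp
    qed
  qed
  define N where "N = density (\<gamma>1 \<Otimes>\<^sub>M \<gamma>2) k"
  note N = nn_integral_density_marginals[OF 1(1) 2(1) k k1 k2, folded N_def]
  have [measurable_cong]: "sets N = sets (\<gamma>1 \<Otimes>\<^sub>M \<gamma>2)" by (simp add: N_def)
  have P': "distr N borel (\<lambda>w. fst (fst w)) = P"
  proof (rule distr_eqI_nn_integral)
    show "sets P = sets borel" using 1(3) by (metis sets_distr)
    then show "(\<integral>\<^sup>+ w. g (fst (fst w)) \<partial>N) = (\<integral>\<^sup>+ z. g z \<partial>P)" if "g \<in> borel_measurable P" for g
      using N(1)[of "\<lambda>v. g (fst v)"] 1(7)[of g] that by (simp cong: measurable_cong_sets)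
  qed measurable
  have R': "distr N borel (\<lambda>w. snd (snd w)) = R"
  proof (rule distr_eqI_nn_integral)
    show "sets R = sets borel" using 2(4) by (metis sets_distr)
    then show "(\<integral>\<^sup>+ w. g (snd (snd w)) \<partial>N) = (\<integral>\<^sup>+ z. g z \<partial>R)" if "g \<in> borel_measurable R" for g
      using N(2)[of "\<lambda>v. g (snd v)"] 2(8)[of g] that by (simp cong: measurable_cong_sets)
  qed measurable
  have "transport_cost P R \<le> (\<integral>\<^sup>+ w. ennreal (dtilde (fst (fst w)) (snd (snd w))) \<partial>N)"
    unfolding P'[symmetric] R'[symmetric] by (rule transport_cost_le[OF N(3)]) auto
  also have "\<dots> \<le> (\<integral>\<^sup>+ w. ennreal (dtilde (fst (fst w)) (snd (fst w))) + ennreal \<delta>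
      + ennreal (dtilde (fst (snd w)) (snd (snd w))) \<partial>N)"
  proof (rule nn_integral_mono_AE)
    have "AE w in N. c (snd (fst w)) = c (fst (snd w))"
      unfolding N_def by (subst AE_density) (auto simp: k_def)
    then show "AE w in N. ennreal (dtilde (fst (fst w)) (snd (snd w)))
      \<le> ennreal (dtilde (fst (fst w)) (snd (fst w))) + ennreal \<delta> + ennreal (dtilde (fst (snd w)) (snd (snd w)))"
    proof (rule AE_mp, intro AE_I2 impI)
      fix w :: "(('dx, 'dy) pt \<times> ('dx, 'dy) pt) \<times> (('dx, 'dy) pt \<times> ('dx, 'dy) pt)"
      assume eq: "c (snd (fst w)) = c (fst (snd w))"
      obtain x y y' z where w: "w = ((x, y), (y', z))" by (metis prod.collapse)
      have "dtilde x z \<le> dtilde x y + (dtilde y (s (c y)) + dtilde (s (c y)) y') + dtilde y' z"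
        using dtilde_triangle[of x z y] dtilde_triangle[of y z y'] dtilde_triangle[of y y' "s (c y)"]
        by linarith
      also have "dtilde y (s (c y)) + dtilde (s (c y)) y' \<le> \<delta>"
        using s[of y] s[of y'] eq by (simp add: w dtilde_commute[of _ y'])
      finally show "ennreal (dtilde (fst (fst w)) (snd (snd w)))
        \<le> ennreal (dtilde (fst (fst w)) (snd (fst w))) + ennreal \<delta> + ennreal (dtilde (fst (snd w)) (snd (snd w)))"
        using \<open>\<delta> > 0\<close> by (simp add: w ennreal_plus[symmetric] del: ennreal_plus)
    qed
  qed
  also have "\<dots> = (\<integral>\<^sup>+ w. ennreal (dtilde (fst (fst w)) (snd (fst w))) \<partial>N) + ennreal \<delta>
      + (\<integral>\<^sup>+ w. ennreal (dtilde (fst (snd w)) (snd (snd w))) \<partial>N)"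
    using prob_space.emeasure_space_1[OF N(3)] by (simp add: nn_integral_add)
  also have "\<dots> = (\<integral>\<^sup>+ v. ennreal (dtilde (fst v) (snd v)) \<partial>\<gamma>1) + ennreal \<delta>
      + (\<integral>\<^sup>+ v. ennreal (dtilde (fst v) (snd v)) \<partial>\<gamma>2)"
    using N(1)[of "\<lambda>v. ennreal (dtilde (fst v) (snd v))"] N(2)[of "\<lambda>v. ennreal (dtilde (fst v) (snd v))"]
    by simp
  finally show ?thesis by (simp add: case_prod_beta' ac_simps)
qed

section \<open>The transport distance is a metric\<close>

lemma transport_cost_triangle:
  "transport_cost P R \<le> transport_cost P Q + transport_cost Q R"
proof (cases "transport_cost P Q = \<infinity> \<or> transport_cost Q R = \<infinity>")
  case False
  show ?thesis
  proof (rule ennreal_le_epsilon)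
    fix e :: real assume "e > 0"
    then have e: "ennreal (e / 3) > 0" by simp
    have "transport_cost P Q < transport_cost P Q + ennreal (e / 3)"
      using False e ennreal_add_left_cancel_less[of "transport_cost P Q" 0] by (auto simp: top.not_eq_extremum)
    then obtain \<gamma>1 where \<gamma>1: "\<gamma>1 \<in> couplings P Q"
      "(\<integral>\<^sup>+ (z, z'). ennreal (dtilde z z') \<partial>\<gamma>1) < transport_cost P Q + ennreal (e / 3)"
      using transport_cost_less by blast
    have "transport_cost Q R < transport_cost Q R + ennreal (e / 3)"
      using False e ennreal_add_left_cancel_less[of "transport_cost Q R" 0] by (auto simp: top.not_eq_extremum)
    then obtain \<gamma>2 where \<gamma>2: "\<gamma>2 \<in> couplings Q R"
      "(\<integral>\<^sup>+ (z, z'). ennreal (dtilde z z') \<partial>\<gamma>2) < transport_cost Q R + ennreal (e / 3)"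
      using transport_cost_less by blast
    have "transport_cost P R \<le> (\<integral>\<^sup>+ (z, z'). ennreal (dtilde z z') \<partial>\<gamma>1)
        + (\<integral>\<^sup>+ (z, z'). ennreal (dtilde z z') \<partial>\<gamma>2) + ennreal (e / 3)"
      using \<gamma>1 \<gamma>2 \<open>e > 0\<close> by (intro glue_couplings) auto
    also have "\<dots> \<le> (transport_cost P Q + ennreal (e / 3)) + (transport_cost Q R + ennreal (e / 3)) + ennreal (e / 3)"
      using \<gamma>1(2) \<gamma>2(2) by (intro add_mono) auto
    also have "\<dots> = transport_cost P Q + transport_cost Q R + (ennreal (e / 3) + ennreal (e / 3) + ennreal (e / 3))"
      by (simp add: ac_simps)
    also have "ennreal (e / 3) + ennreal (e / 3) + ennreal (e / 3) = ennreal e"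
      using \<open>e > 0\<close> by (simp add: ennreal_plus[symmetric] del: ennreal_plus)
    finally show "transport_cost P R \<le> transport_cost P Q + transport_cost Q R + ennreal e" .
  qed
qed auto

lemma transport_cost_commute: "transport_cost P Q = transport_cost Q P"
proof -
  have "transport_cost Q P \<le> transport_cost P Q" for P Q :: "('dx::finite, 'dy::finite) pt measure"
    unfolding transport_cost_def[of P Q]
  proof (rule INF_greatest)
    fix \<gamma> assume *: "\<gamma> \<in> couplings P Q"
    have "transport_cost (distr \<gamma> borel snd) (distr \<gamma> borel fst)
        \<le> (\<integral>\<^sup>+ w. ennreal (dtilde (snd w) (fst w)) \<partial>\<gamma>)"
      by (intro transport_cost_le couplingsD[OF *])
    then show "transport_cost Q P \<le> (\<integral>\<^sup>+ (z, z'). ennreal (dtilde z z') \<partial>\<gamma>)"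
      using couplingsD(3,4)[OF *]
      by (subst (asm) dtilde_commute) (simp add: case_prod_beta')
  qed
  then show ?thesis by (intro antisym)
qed

lemma transport_cost_self:
  assumes "prob_space P" "sets P = sets borel"
  shows "transport_cost P P = 0"
proof -
  have [measurable]: "(\<lambda>z. z) \<in> borel_measurable P"
    using assms(2) by (simp cong: measurable_cong_sets)
  have "transport_cost (distr P borel (\<lambda>z. z)) (distr P borel (\<lambda>z. z)) \<le> (\<integral>\<^sup>+ w. ennreal (dtilde w w) \<partial>P)"
    by (intro transport_cost_le assms) auto
  moreover have "distr P borel (\<lambda>z. z) = P" 
    using assms(2) by (intro distr_id2) auto
  ultimately show ?thesis by simp
qed

text \<open>
  Open sets are increasing limits of bounded functions that are Lipschitz for \<^const>\<open>dtilde\<close>,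
  so that a vanishing transport cost forces equality of the marginals.
\<close>

lemma infdist_dtilde_Lipschitz:
  "min 1 (real n * infdist z C) \<le> min 1 (real n * infdist w C) + real (Suc n) * dtilde z w"
proof -
  have "infdist z C \<le> infdist w C + dist z w"
    by (rule infdist_triangle)
  then have "real n * infdist z C \<le> real n * infdist w C + real n * dist z w"
    by (simp add: distrib_left[symmetric] mult_left_mono)
  moreover have "0 \<le> real n * infdist w C"
    by (simp add: infdist_nonneg)
  moreover have "min 1 (real n * dist z w) \<le> real (Suc n) * dtilde z w"
  proof -
    have "min 1 (real n * dist z w) \<le> real (Suc n) * min (dist z w) 1"
    proof (cases "dist z w \<le> 1")
      case True
      have "real n * dist z w \<le> real (Suc n) * dist z w"
        by (intro mult_right_mono) auto
      then show ?thesis using True by (simp add: min_def)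
    qed (simp add: min_def)
    also have "\<dots> \<le> real (Suc n) * dtilde z w"
      by (intro mult_left_mono min_dist_le_dtilde) auto
    finally show ?thesis .
  qed
  moreover have "0 \<le> real n * dist z w"
    by simp
  moreover have "min 1 a \<le> min 1 b + e" if "a \<le> b + d" "0 \<le> b" "0 \<le> d" "min 1 d \<le> e" for a b d e :: real
    using that unfolding min_def by (auto split: if_splits)
  ultimately show ?thesis
    by blast
qed

lemma nn_integral_le_transport_cost:
  fixes P Q :: "('dx::finite, 'dy::finite) pt measure"
  assumes [measurable]: "f \<in> borel_measurable borel" and "L \<ge> 0" "\<And>z. f z \<ge> 0"
    and f: "\<And>z w. f z \<le> f w + L * dtilde z w"
    and 0: "transport_cost P Q = 0"
  shows "(\<integral>\<^sup>+ z. ennreal (f z) \<partial>P) \<le> (\<integral>\<^sup>+ z. ennreal (f z) \<partial>Q)"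
proof (rule ennreal_le_epsilon)
  fix e :: real assume "e > 0"
  then have "transport_cost P Q < ennreal (e / (L + 1))"
    using \<open>L \<ge> 0\<close> by (simp add: 0)
  then obtain \<gamma> where \<gamma>: "\<gamma> \<in> couplings P Q"
    "(\<integral>\<^sup>+ (z, z'). ennreal (dtilde z z') \<partial>\<gamma>) < ennreal (e / (L + 1))"
    using transport_cost_less by blast
  note D = couplingsD[OF \<gamma>(1)]
  note [measurable] = D(5,6)
  have "(\<integral>\<^sup>+ z. ennreal (f z) \<partial>P) = (\<integral>\<^sup>+ w. ennreal (f (fst w)) \<partial>\<gamma>)"
    using D(7)[of "\<lambda>z. ennreal (f z)"] by simp
  also have "\<dots> \<le> (\<integral>\<^sup>+ w. ennreal (f (snd w)) + ennreal L * ennreal (dtilde (fst w) (snd w)) \<partial>\<gamma>)"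
  proof (rule nn_integral_mono)
    fix w
    show "ennreal (f (fst w)) \<le> ennreal (f (snd w)) + ennreal L * ennreal (dtilde (fst w) (snd w))"
      using f[of "fst w" "snd w"] assms(2,3)
      by (simp add: ennreal_mult[symmetric] ennreal_plus[symmetric] del: ennreal_plus)
  qed
  also have "\<dots> = (\<integral>\<^sup>+ w. ennreal (f (snd w)) \<partial>\<gamma>) + ennreal L * (\<integral>\<^sup>+ w. ennreal (dtilde (fst w) (snd w)) \<partial>\<gamma>)"
    by (simp add: nn_integral_add nn_integral_cmult)
  also have "(\<integral>\<^sup>+ w. ennreal (f (snd w)) \<partial>\<gamma>) = (\<integral>\<^sup>+ z. ennreal (f z) \<partial>Q)"
    using D(8)[of "\<lambda>z. ennreal (f z)"] by simp
  also have "ennreal L * (\<integral>\<^sup>+ w. ennreal (dtilde (fst w) (snd w)) \<partial>\<gamma>) \<le> ennreal L * ennreal (e / (L + 1))"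
    using \<gamma>(2) by (intro mult_left_mono) (auto simp: case_prod_beta')
  also have "\<dots> \<le> ennreal e"
    using \<open>e > 0\<close> \<open>L \<ge> 0\<close> by (subst ennreal_mult[symmetric]) (auto simp: field_simps intro!: ennreal_leI)
  finally show "(\<integral>\<^sup>+ z. ennreal (f z) \<partial>P) \<le> (\<integral>\<^sup>+ z. ennreal (f z) \<partial>Q) + ennreal e"
    by (simp add: add_left_mono)
qed

lemma transport_cost_eq_0_imp_eq:
  fixes P Q :: "('dx::finite, 'dy::finite) pt measure"
  assumes P: "prob_space P" "sets P = sets borel" and Q: "prob_space Q" "sets Q = sets borel"
    and 0: "transport_cost P Q = 0"
  shows "P = Q"
proof -
  have le: "emeasure P U \<le> emeasure Q U" if "open U" and P: "sets P = sets borel" 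
    and Q: "sets Q = sets borel" and sp: "emeasure P UNIV = 1" "emeasure Q UNIV = 1"
    and 0: "transport_cost P Q = 0"
    for U and P Q :: "('dx, 'dy) pt measure"
  proof (cases "U = UNIV")
    case False
    define f where "f n z = min 1 (real n * infdist z (- U))" for n z
    have [measurable]: "f n \<in> borel_measurable borel" for n
    proof -
      have [measurable]: "(\<lambda>z. infdist z (- U)) \<in> borel_measurable borel"
        by (intro borel_measurable_continuous_onI continuous_intros)
      show ?thesis unfolding f_def
        by (intro borel_measurable_min borel_measurable_times borel_measurable_const) measurable
    qed
    have "incseq (\<lambda>n. ennreal (f n z))" for z
      unfolding f_def
      by (intro monoI ennreal_leI min.mono mult_right_mono) (auto simp: infdist_nonneg)
    then have inc: "incseq (\<lambda>n z. ennreal (f n z))"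
      by (auto simp: mono_def le_fun_def)
    have lim: "(SUP n. ennreal (f n z)) = indicator U z" for z
    proof (cases "z \<in> U")
      case True
      have "z \<notin> closure (- U)"
        using True \<open>open U\<close> by (simp add: closure_complement interior_open)
      then have "infdist z (- U) > 0"
        using in_closure_iff_infdist_zero[of "- U" z] infdist_nonneg[of z "- U"] False by force
      then obtain n where "1 < real n * infdist z (- U)"
        using reals_Archimedean3 by blast
      then have "ennreal (f n z) = 1" by (simp add: f_def)
      then have "1 \<le> (SUP n. ennreal (f n z))" by (metis SUP_upper UNIV_I)
      moreover have "(SUP n. ennreal (f n z)) \<le> 1"
        by (intro SUP_least) (simp add: f_def)
      ultimately show ?thesis using True by simp
    next
      case False
      then have "infdist z (- U) = 0" by simp
      then show ?thesis using False by (simp add: f_def)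
    qed
    have *: "emeasure N U = (SUP n. \<integral>\<^sup>+ z. ennreal (f n z) \<partial>N)" if "sets N = sets borel" for N
    proof -
      have [measurable_cong]: "sets N = sets borel" by fact
      have "emeasure N U = (\<integral>\<^sup>+ z. (SUP n. ennreal (f n z)) \<partial>N)"
        using \<open>open U\<close> that by (simp add: lim)
      also have "\<dots> = (SUP n. \<integral>\<^sup>+ z. ennreal (f n z) \<partial>N)"
        by (rule nn_integral_monotone_convergence_SUP[OF inc]) simp
      finally show ?thesis .
    qed
    show ?thesis
      unfolding *[OF P] *[OF Q]
    proof (intro SUP_mono)
      fix n
      have "(\<integral>\<^sup>+ z. ennreal (f n z) \<partial>P) \<le> (\<integral>\<^sup>+ z. ennreal (f n z) \<partial>Q)"
      proof (rule nn_integral_le_transport_cost)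
        show "f n z \<le> f n w + real (Suc n) * dtilde z w" for z w
          unfolding f_def by (rule infdist_dtilde_Lipschitz)
        show "0 \<le> f n z" for z
          by (simp add: f_def infdist_nonneg)
      qed (simp_all add: 0)
      then show "\<exists>m\<in>UNIV. (\<integral>\<^sup>+ z. ennreal (f n z) \<partial>P) \<le> (\<integral>\<^sup>+ z. ennreal (f m z) \<partial>Q)"
        by auto
    qed
  qed (simp add: sp)
  have one: "emeasure P UNIV = 1" "emeasure Q UNIV = 1"
    using prob_space.emeasure_space_1[OF P(1)] prob_space.emeasure_space_1[OF Q(1)]
      sets_eq_imp_space_eq[OF P(2)] sets_eq_imp_space_eq[OF Q(2)] by auto
  show ?thesis
  proof (rule measure_eqI_generator_eq[where E = "{U. open U}" and A = "\<lambda>_. UNIV" and \<Omega> = UNIV])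
    show "emeasure P U = emeasure Q U" if "U \<in> {U. open U}" for U
      using le[of U P Q] le[of U Q P] that P Q one 0 by (auto simp: transport_cost_commute intro!: antisym)
  qed (auto simp: Int_stable_def P Q one borel_def)
qed

lemma transport_cost_finite:
  assumes "P \<in> P1tilde" "Q \<in> P1tilde"
  shows "transport_cost P Q < \<infinity>"
proof -
  have P: "prob_space P" and [measurable_cong]: "sets P = sets borel"
    and Pf: "(\<integral>\<^sup>+ z. ennreal (dtilde z 0) \<partial>P) < \<infinity>"
    and Q: "prob_space Q" and [measurable_cong]: "sets Q = sets borel"
    and Qf: "(\<integral>\<^sup>+ z. ennreal (dtilde z 0) \<partial>Q) < \<infinity>"
    using assms by (auto simp: P1tilde_def)
  interpret A: prob_space P by fact
  interpret B: prob_space Q by fact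
  interpret pair_prob_space P Q ..
  have *: "AE a in P. (\<integral>\<^sup>+ b. 1 \<partial>Q) = 1" "AE a in Q. (\<integral>\<^sup>+ b. 1 \<partial>P) = 1"
    by (simp_all add: A.emeasure_space_1 B.emeasure_space_1)
  note N = nn_integral_density_marginals[OF P Q _ *, simplified density_1]
  have "distr (P \<Otimes>\<^sub>M Q) borel fst = P"
    by (intro distr_eqI_nn_integral N) (auto simp: \<open>sets P = sets borel\<close> cong: measurable_cong_sets)
  moreover have "distr (P \<Otimes>\<^sub>M Q) borel snd = Q"
    by (intro distr_eqI_nn_integral N) (auto simp: \<open>sets Q = sets borel\<close> cong: measurable_cong_sets)
  ultimately have "transport_cost P Q \<le> (\<integral>\<^sup>+ w. ennreal (dtilde (fst w) (snd w)) \<partial>(P \<Otimes>\<^sub>M Q))"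
    using transport_cost_le[of "P \<Otimes>\<^sub>M Q" fst snd] prob_space_axioms by simp
  also have "\<dots> \<le> (\<integral>\<^sup>+ w. ennreal (dtilde (fst w) 0) + ennreal (dtilde (snd w) 0) \<partial>(P \<Otimes>\<^sub>M Q))"
    using dtilde_triangle[of _ _ 0]
    by (intro nn_integral_mono)
       (auto simp: dtilde_commute[of 0] ennreal_plus[symmetric] simp del: ennreal_plus intro!: ennreal_leI)
  also have "\<dots> = (\<integral>\<^sup>+ z. ennreal (dtilde z 0) \<partial>P) + (\<integral>\<^sup>+ z. ennreal (dtilde z 0) \<partial>Q)"
    using N(1)[of "\<lambda>z. ennreal (dtilde z 0)"] N(2)[of "\<lambda>z. ennreal (dtilde z 0)"]
    by (simp add: nn_integral_add)
  also have "\<dots> < \<infinity>" using Pf Qf by simp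
  finally show ?thesis .
qed

lemma Metric_space_W1tilde: "Metric_space P1tilde W1tilde"
proof
  fix P Q R :: "('dx::finite, 'dy::finite) pt measure"
  show "0 \<le> W1tilde P Q" by (simp add: W1tilde_def)
  show "W1tilde P Q = W1tilde Q P" by (simp add: W1tilde_eq transport_cost_commute)
  assume P: "P \<in> P1tilde" and Q: "Q \<in> P1tilde"
  then show "W1tilde P Q = 0 \<longleftrightarrow> P = Q"
    using transport_cost_finite[OF P Q] transport_cost_eq_0_imp_eq[of P Q] transport_cost_self[of P]
    by (auto simp: W1tilde_eq P1tilde_def enn2real_eq_0_iff)
  assume R: "R \<in> P1tilde"
  have "enn2real (transport_cost P R) \<le> enn2real (transport_cost P Q + transport_cost Q R)"
    using transport_cost_finite[OF P Q] transport_cost_finite[OF Q R]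
    by (intro enn2real_mono transport_cost_triangle) auto
  also have "\<dots> = enn2real (transport_cost P Q) + enn2real (transport_cost Q R)"
    using transport_cost_finite[OF P Q] transport_cost_finite[OF Q R] by (intro enn2real_plus) auto
  finally show "W1tilde P R \<le> W1tilde P Q + W1tilde Q R" by (simp add: W1tilde_eq)
qed

section \<open>Couplings from finitely many cells\<close>

lemma has_bochner_integral_finite_valued:
  fixes h :: "'b \<Rightarrow> real"
  assumes "finite_measure P" and [measurable]: "c \<in> P \<rightarrow>\<^sub>M count_space UNIV"
    and "finite J" and J: "\<And>z. z \<in> space P \<Longrightarrow> c z \<in> J"
  shows "has_bochner_integral P (\<lambda>z. h (c z)) (\<Sum>j\<in>J. h j * measure P {z \<in> space P. c z = j})"
proof -
  interpret finite_measure P by fact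
  have "has_bochner_integral P (\<lambda>z. \<Sum>j\<in>J. h j * indicator {z \<in> space P. c z = j} z)
      (\<Sum>j\<in>J. h j * measure P {z \<in> space P. c z = j})"
    by (intro has_bochner_integral_sum has_bochner_integral_mult_right
        has_bochner_integral_real_indicator) (auto simp: less_top[symmetric])
  also have "?this \<longleftrightarrow> ?thesis"
  proof (rule has_bochner_integral_cong)
    fix z assume z: "z \<in> space P"
    have "(\<Sum>j\<in>J. h j * indicator {z \<in> space P. c z = j} z) = (\<Sum>j\<in>J. if j = c z then h j else 0)"
      using z by (intro sum.cong) (auto simp: indicator_def)
    then show "(\<Sum>j\<in>J. h j * indicator {z \<in> space P. c z = j} z) = h (c z)"
      using \<open>finite J\<close> J[OF z] by simp
  qed simp_all
  finally show ?thesis .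
qed

lemma nn_integral_finite_valued:
  fixes h :: "'b \<Rightarrow> real"
  assumes "finite_measure P" "c \<in> P \<rightarrow>\<^sub>M count_space UNIV" "finite J"
    "\<And>z. z \<in> space P \<Longrightarrow> c z \<in> J" and "\<And>j. 0 \<le> h j"
  shows "(\<integral>\<^sup>+ z. ennreal (h (c z)) \<partial>P) = ennreal (\<Sum>j\<in>J. h j * measure P {z \<in> space P. c z = j})"
  using has_bochner_integral_finite_valued[OF assms(1-4), of h] assms(5)
  by (simp add: has_bochner_integral_iff nn_integral_eq_integral)

text \<open>
  If two laws give nearly the same masses \<open>p i\<close> and \<open>q i\<close> to finitely many cells, they are close
  up to the error of moving each point to the reference point of its cell. The coupling is the
  maximal coupling of the vectors \<open>p\<close> and \<open>q\<close>, with conditional independence within the cells.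
\<close>

lemma transport_cost_finite_cells:
  fixes P Q :: "('dx::finite, 'dy::finite) pt measure" and s :: "nat \<Rightarrow> ('dx, 'dy) pt"
  assumes P: "prob_space P" "sets P = sets borel" and Q: "prob_space Q" "sets Q = sets borel"
    and c [measurable]: "c \<in> borel \<rightarrow>\<^sub>M count_space UNIV" and fin: "finite J" and J: "\<And>z. c z \<in> J"
    and "D \<ge> 0" and D: "\<And>i j. i \<in> J \<Longrightarrow> j \<in> J \<Longrightarrow> dtilde (s i) (s j) \<le> D"
  shows "transport_cost P Q \<le> (\<integral>\<^sup>+ z. ennreal (dtilde z (s (c z))) \<partial>P) + (\<integral>\<^sup>+ z. ennreal (dtilde z (s (c z))) \<partial>Q)
    + ennreal (D * (1 - (\<Sum>i\<in>J. min (measure P {z. c z = i}) (measure Q {z. c z = i}))))"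
proof -
  interpret A: prob_space P by fact
  interpret B: prob_space Q by fact
  interpret pair_prob_space P Q ..
  have [measurable_cong]: "sets P = sets borel" "sets Q = sets borel" by fact+
  have [simp]: "space P = UNIV" "space Q = UNIV"
    using sets_eq_imp_space_eq[OF P(2)] sets_eq_imp_space_eq[OF Q(2)] by auto
  define p where "p i = measure P {z. c z = i}" for i
  define q where "q i = measure Q {z. c z = i}" for i
  define m where "m i = min (p i) (q i)" for i
  define S where "S = (\<Sum>i\<in>J. m i)"
  \<comment> \<open>The coupling matrix \<open>K i j * p i * q j\<close> puts \<open>m i\<close> on the diagonal and couples the remaining
    masses independently. Divisions by zero yield \<open>0\<close>, so that empty cells and the case \<open>S = 1\<close>
    are covered by the same formula.\<close>
  define r where "r i = (p i - m i) / p i" for i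
  define t where "t j = (q j - m j) / (q j * (1 - S))" for j
  define K where "K i j = (if i = j then m i / (p i * q i) else 0) + r i * t j" for i j
  have nn: "0 \<le> p i" "0 \<le> q i" "0 \<le> m i" "m i \<le> p i" "m i \<le> q i" for i
    by (auto simp: p_def q_def m_def)
  have intP: "(\<integral>\<^sup>+ z. ennreal (h (c z)) \<partial>P) = ennreal (\<Sum>j\<in>J. h j * p j)" if "\<And>j. 0 \<le> h j" for h
    using nn_integral_finite_valued[OF A.finite_measure_axioms, of c J h] that fin J by (simp add: p_def)
  have intQ: "(\<integral>\<^sup>+ z. ennreal (h (c z)) \<partial>Q) = ennreal (\<Sum>j\<in>J. h j * q j)" if "\<And>j. 0 \<le> h j" for h
    using nn_integral_finite_valued[OF B.finite_measure_axioms, of c J h] that fin J by (simp add: q_def)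
  have p1: "(\<Sum>j\<in>J. p j) = 1"
    using intP[of "\<lambda>_. 1"] A.emeasure_space_1 by (simp add: sum_nonneg nn)
  have q1: "(\<Sum>j\<in>J. q j) = 1"
    using intQ[of "\<lambda>_. 1"] B.emeasure_space_1 by (simp add: sum_nonneg nn)
  have S1: "S \<le> 1"
    unfolding S_def p1[symmetric] by (intro sum_mono nn)
  have pm: "(\<Sum>j\<in>J. p j - m j) = 1 - S" and qm: "(\<Sum>j\<in>J. q j - m j) = 1 - S"
    by (simp_all add: sum_subtractf p1 q1 S_def)
  have rp: "r i * p i = p i - m i" for i
    using nn[of i] by (auto simp: r_def)
  have tq: "t j * q j = (q j - m j) / (1 - S)" for j
    using nn[of j] by (auto simp: t_def)
  have sum_r: "(\<Sum>i\<in>J. r i * p i) = 1 - S"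
    by (simp add: rp pm)
  have sum_t: "(\<Sum>j\<in>J. t j * q j) = (1 - S) / (1 - S)"
    by (simp add: tq qm flip: sum_divide_distrib)
  have rt: "0 \<le> r i" "0 \<le> t i" for i
    using nn[of i] S1 by (auto simp: r_def t_def)
  have K0: "0 \<le> K i j" for i j
    using nn[of i] rt by (auto simp: K_def)
  have row: "(\<Sum>j\<in>J. K i j * q j) = 1" if "p i \<noteq> 0" "i \<in> J" for i
  proof -
    have "(\<Sum>j\<in>J. K i j * q j) = (\<Sum>j\<in>J. (if i = j then m i / (p i * q i) * q i else 0)) + r i * (\<Sum>j\<in>J. t j * q j)"
    proof -
      have "K i j * q j = (if i = j then m i / (p i * q i) * q i else 0) + r i * (t j * q j)" for j
        by (simp add: K_def algebra_simps)
      then show ?thesis by (simp add: sum.distrib sum_distrib_left)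
    qed
    also have "\<dots> = m i / p i + r i * ((1 - S) / (1 - S))"
      using that fin nn[of i] by (auto simp: sum_t)
    also have "\<dots> = 1"
    proof (cases "S = 1")
      case True
      then have "p i - m i = 0"
        using pm that(2) fin nn sum_nonneg_eq_0_iff[of J "\<lambda>j. p j - m j"] by auto
      then show ?thesis using that by (simp add: r_def)
    next
      case False
      then show ?thesis using that by (simp add: r_def field_simps)
    qed
    finally show ?thesis .
  qed
  have col: "(\<Sum>i\<in>J. K i j * p i) = 1" if "q j \<noteq> 0" "j \<in> J" for j
  proof -
    have "(\<Sum>i\<in>J. K i j * p i) = (\<Sum>i\<in>J. (if i = j then m j / (p j * q j) * p j else 0)) + t j * (\<Sum>i\<in>J. r i * p i)"
    proof -
      have "K i j * p i = (if i = j then m j / (p j * q j) * p j else 0) + t j * (r i * p i)" for i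
        by (simp add: K_def algebra_simps)
      then show ?thesis by (simp add: sum.distrib sum_distrib_left)
    qed
    also have "\<dots> = m j / q j + t j * (1 - S)"
      using that fin nn[of j] by (auto simp: sum_r)
    also have "\<dots> = 1"
    proof (cases "S = 1")
      case True
      then have "q j - m j = 0"
        using qm that(2) fin nn sum_nonneg_eq_0_iff[of J "\<lambda>j. q j - m j"] by auto
      then show ?thesis using that by (simp add: t_def)
    next
      case False
      then show ?thesis using that by (simp add: t_def field_simps)
    qed
    finally show ?thesis .
  qed
  define k where "k w = ennreal (K (c (fst w)) (c (snd w)))" for w
  have pair: "(\<lambda>w. (c (fst w), c (snd w))) \<in> P \<Otimes>\<^sub>M Q \<rightarrow>\<^sub>M count_space UNIV"
  proof -
    have "(\<lambda>w. (c (fst w), c (snd w))) \<in> P \<Otimes>\<^sub>M Q \<rightarrow>\<^sub>M count_space UNIV \<Otimes>\<^sub>M count_space UNIV"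
      by measurable
    then show ?thesis by (simp add: pair_measure_countable)
  qed
  have k [measurable]: "k \<in> borel_measurable (P \<Otimes>\<^sub>M Q)"
    using measurable_compose[OF pair, of "\<lambda>(i, j). ennreal (K i j)" borel] by (simp add: k_def[abs_def])
  have p0: "AE z in P. p (c z) \<noteq> 0"
    using AE_cell_nonnull[OF P(2) c] by (simp add: p_def A.emeasure_eq_measure)
  have q0: "AE z in Q. q (c z) \<noteq> 0"
    using AE_cell_nonnull[OF Q(2) c] by (simp add: q_def B.emeasure_eq_measure)
  have k1: "AE a in P. (\<integral>\<^sup>+ b. k (a, b) \<partial>Q) = 1"
    using p0 by (rule AE_mp) (auto intro!: AE_I2 simp: k_def intQ K0 row J)
  have k2: "AE b in Q. (\<integral>\<^sup>+ a. k (a, b) \<partial>P) = 1"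
    using q0 by (rule AE_mp) (auto intro!: AE_I2 simp: k_def intP[of "\<lambda>i. K i _"] K0 col J)
  define N where "N = density (P \<Otimes>\<^sub>M Q) k"
  note N = nn_integral_density_marginals[OF P(1) Q(1) k k1 k2, folded N_def]
  have [measurable_cong]: "sets N = sets (P \<Otimes>\<^sub>M Q)" by (simp add: N_def)
  have P': "distr N borel fst = P"
    by (rule distr_eqI_nn_integral[OF P(2)]) (auto intro: N)
  have Q': "distr N borel snd = Q"
    by (rule distr_eqI_nn_integral[OF Q(2)]) (auto intro: N)
  have [measurable]: "(\<lambda>z. s (c z)) \<in> borel_measurable borel"
    by (rule measurable_compose[OF c]) simp
  have "transport_cost P Q \<le> (\<integral>\<^sup>+ w. ennreal (dtilde (fst w) (snd w)) \<partial>N)"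
    using transport_cost_le[OF N(3), of fst snd] by (simp add: P' Q')
  also have "\<dots> \<le> (\<integral>\<^sup>+ w. ennreal (dtilde (fst w) (s (c (fst w)))) + ennreal (dtilde (snd w) (s (c (snd w))))
      + ennreal (dtilde (s (c (fst w))) (s (c (snd w)))) \<partial>N)"
  proof (rule nn_integral_mono)
    fix w :: "('dx, 'dy) pt \<times> ('dx, 'dy) pt"
    have "dtilde (fst w) (snd w) \<le> dtilde (fst w) (s (c (fst w))) + dtilde (snd w) (s (c (snd w)))
      + dtilde (s (c (fst w))) (s (c (snd w)))"
      using dtilde_triangle[of "fst w" "snd w" "s (c (fst w))"]
        dtilde_triangle[of "s (c (fst w))" "snd w" "s (c (snd w))"]
      by (simp add: dtilde_commute[of _ "snd w"])
    then show "ennreal (dtilde (fst w) (snd w)) \<le> ennreal (dtilde (fst w) (s (c (fst w))))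
       + ennreal (dtilde (snd w) (s (c (snd w)))) + ennreal (dtilde (s (c (fst w))) (s (c (snd w))))"
      by (simp add: ennreal_plus[symmetric] del: ennreal_plus)
  qed
  also have "\<dots> = (\<integral>\<^sup>+ z. ennreal (dtilde z (s (c z))) \<partial>P) + (\<integral>\<^sup>+ z. ennreal (dtilde z (s (c z))) \<partial>Q)
      + (\<integral>\<^sup>+ w. ennreal (dtilde (s (c (fst w))) (s (c (snd w)))) \<partial>N)"
    using N(1)[of "\<lambda>z. ennreal (dtilde z (s (c z)))"] N(2)[of "\<lambda>z. ennreal (dtilde z (s (c z)))"]
    by (simp add: nn_integral_add)
  also have "(\<integral>\<^sup>+ w. ennreal (dtilde (s (c (fst w))) (s (c (snd w)))) \<partial>N)
      = (\<integral>\<^sup>+ w. k w * ennreal (dtilde (s (c (fst w))) (s (c (snd w)))) \<partial>(P \<Otimes>\<^sub>M Q))"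
    unfolding N_def by (rule nn_integral_density) auto
  also have "\<dots> = (\<integral>\<^sup>+ a. \<integral>\<^sup>+ b. k (a, b) * ennreal (dtilde (s (c a)) (s (c b))) \<partial>Q \<partial>P)"
    by (subst B.nn_integral_fst[symmetric]) auto
  also have "\<dots> \<le> (\<integral>\<^sup>+ a. \<integral>\<^sup>+ b. ennreal (D * r (c a)) * ennreal (t (c b)) \<partial>Q \<partial>P)"
  proof (intro nn_integral_mono)
    fix a b
    have "K (c a) (c b) * dtilde (s (c a)) (s (c b)) = r (c a) * t (c b) * dtilde (s (c a)) (s (c b))"
      by (simp add: K_def)
    also have "\<dots> \<le> r (c a) * t (c b) * D"
      using rt J by (intro mult_left_mono D) auto
    finally show "k (a, b) * ennreal (dtilde (s (c a)) (s (c b))) \<le> ennreal (D * r (c a)) * ennreal (t (c b))"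
      using K0 rt \<open>D \<ge> 0\<close> by (simp add: k_def ennreal_mult[symmetric] ac_simps)
  qed
  also have "\<dots> = (\<integral>\<^sup>+ a. ennreal (D * r (c a)) * ennreal ((1 - S) / (1 - S)) \<partial>P)"
  proof (rule nn_integral_cong)
    fix a
    have [measurable]: "(\<lambda>b. ennreal (t (c b))) \<in> borel_measurable Q"
      by (rule measurable_compose[where N = "count_space UNIV"]) auto
    show "(\<integral>\<^sup>+ b. ennreal (D * r (c a)) * ennreal (t (c b)) \<partial>Q) = ennreal (D * r (c a)) * ennreal ((1 - S) / (1 - S))"
      using rt by (subst nn_integral_cmult) (auto simp: intQ sum_t)
  qed
  also have "\<dots> \<le> (\<integral>\<^sup>+ a. ennreal (D * r (c a)) \<partial>P)"
    by (intro nn_integral_mono) (auto simp: divide_self_if)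
  also have "\<dots> = ennreal (D * (1 - S))"
    using intP[of "\<lambda>i. D * r i"] rt \<open>D \<ge> 0\<close> by (simp add: mult.assoc sum_r flip: sum_distrib_left)
  finally show ?thesis
    by (simp add: S_def m_def p_def q_def add_left_mono)
qed

section \<open>The entropy inequality\<close>

lemma KL_leD:
  assumes "KL Q R \<le> ereal a"
  shows "absolutely_continuous R Q" "integrable Q (\<lambda>z. ln (enn2real (RN_deriv R Q z)))"
    "(\<integral>z. ln (enn2real (RN_deriv R Q z)) \<partial>Q) \<le> a"
proof -
  have eq: "entropy_density (exp 1) R Q = (\<lambda>z. ln (enn2real (RN_deriv R Q z)))"
    by (auto simp: entropy_density_def log_def fun_eq_iff)
  show "absolutely_continuous R Q" "integrable Q (\<lambda>z. ln (enn2real (RN_deriv R Q z)))"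
    "(\<integral>z. ln (enn2real (RN_deriv R Q z)) \<partial>Q) \<le> a"
    using assms by (auto simp: KL_def KL_divergence_def eq split: if_splits)
qed

lemma AE_RN_deriv_pos:
  assumes "prob_space R" "prob_space Q" "sets Q = sets R" "absolutely_continuous R Q"
  shows "AE z in Q. 0 < enn2real (RN_deriv R Q z)"
proof -
  interpret R: prob_space R by fact
  interpret Q: prob_space Q by fact
  have "AE z in R. RN_deriv R Q z \<noteq> \<infinity>"
    using R.RN_deriv_finite[of Q] assms Q.sigma_finite_measure_axioms by auto
  then have "AE z in R. 0 < RN_deriv R Q z \<longrightarrow> 0 < enn2real (RN_deriv R Q z)"
    by (rule AE_mp) (auto intro!: AE_I2 simp: enn2real_positive_iff less_top)
  then have "AE z in density R (RN_deriv R Q). 0 < enn2real (RN_deriv R Q z)"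
    by (subst AE_density) auto
  then show ?thesis
    unfolding R.density_RN_deriv[OF assms(4,3)] .
qed

lemma nn_integral_div_RN_deriv_le:
  fixes g :: "'a \<Rightarrow> real"
  assumes "prob_space R" "prob_space Q" "sets Q = sets R" "absolutely_continuous R Q"
    and [measurable]: "g \<in> borel_measurable R" and g: "\<And>z. 0 \<le> g z"
  shows "(\<integral>\<^sup>+ z. ennreal (g z / enn2real (RN_deriv R Q z)) \<partial>Q) \<le> (\<integral>\<^sup>+ z. ennreal (g z) \<partial>R)"
proof -
  interpret R: prob_space R by fact
  interpret Q: prob_space Q by fact
  have fin: "AE z in R. RN_deriv R Q z \<noteq> \<infinity>"
    using R.RN_deriv_finite[of Q] assms Q.sigma_finite_measure_axioms by auto
  have "(\<integral>\<^sup>+ z. ennreal (g z / enn2real (RN_deriv R Q z)) \<partial>Q)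
      = (\<integral>\<^sup>+ z. RN_deriv R Q z * ennreal (g z / enn2real (RN_deriv R Q z)) \<partial>R)"
    using assms by (intro R.RN_deriv_nn_integral) auto
  also have "\<dots> \<le> (\<integral>\<^sup>+ z. ennreal (g z) \<partial>R)"
  proof (intro nn_integral_mono_AE, use fin in \<open>rule AE_mp\<close>, intro AE_I2 impI)
    fix z assume "RN_deriv R Q z \<noteq> \<infinity>"
    then obtain t where t: "RN_deriv R Q z = ennreal t" "0 \<le> t"
      by (cases "RN_deriv R Q z") auto
    have "t * (g z / t) \<le> g z"
      using g[of z] by (cases "t = 0") auto
    then show "RN_deriv R Q z * ennreal (g z / enn2real (RN_deriv R Q z)) \<le> ennreal (g z)"
      using t by (simp add: ennreal_mult'[symmetric] ennreal_leI)
  qed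
  finally show ?thesis .
qed

text \<open>
  The linear form of the Donsker-Varadhan inequality. With \<open>f = dQ/dR\<close> it integrates
  \<open>\<phi> - ln f \<le> exp \<phi> / f - 1\<close> against \<open>Q\<close>.
\<close>

lemma entropy_inequality:
  fixes \<phi> :: "'a \<Rightarrow> real"
  assumes R: "prob_space R" and Q: "prob_space Q" and eq: "sets Q = sets R"
    and KL: "KL Q R \<le> ereal a"
    and \<phi> [measurable]: "\<phi> \<in> borel_measurable R" and lower: "\<And>z. - b \<le> \<phi> z"
    and exp: "integrable R (\<lambda>z. exp (\<phi> z))"
  shows "integrable Q \<phi>" and "(\<integral>z. \<phi> z \<partial>Q) \<le> a + (\<integral>z. exp (\<phi> z) \<partial>R) - 1"
proof -
  interpret R: prob_space R by fact
  interpret Q: prob_space Q by fact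
  have [measurable_cong]: "sets Q = sets R" by fact
  define f where "f z = enn2real (RN_deriv R Q z)" for z
  define g where "g z = exp (\<phi> z) / f z" for z
  have [measurable]: "f \<in> borel_measurable R" "g \<in> borel_measurable R"
    unfolding f_def g_def by measurable
  note KL = KL_leD[OF KL, folded f_def]
  have f_pos: "AE z in Q. 0 < f z"
    unfolding f_def by (rule AE_RN_deriv_pos[OF R Q eq KL(1)])
  have "(\<integral>\<^sup>+ z. ennreal (g z) \<partial>Q) \<le> (\<integral>\<^sup>+ z. ennreal (exp (\<phi> z)) \<partial>R)"
    unfolding g_def f_def by (rule nn_integral_div_RN_deriv_le[OF R Q eq KL(1)]) auto
  also have "\<dots> = ennreal (\<integral>z. exp (\<phi> z) \<partial>R)"
    using exp by (intro nn_integral_eq_integral) auto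
  finally have g_le: "(\<integral>\<^sup>+ z. ennreal (g z) \<partial>Q) \<le> ennreal (\<integral>z. exp (\<phi> z) \<partial>R)" .
  have g0: "0 \<le> g z" for z
    by (simp add: g_def f_def)
  have g: "integrable Q g"
    by (rule integrableI_bounded) (use g_le g0 in \<open>auto simp: top.extremum_strict less_top[symmetric] top_unique\<close>)
  have g_int: "(\<integral>z. g z \<partial>Q) \<le> (\<integral>z. exp (\<phi> z) \<partial>R)"
    using g_le nn_integral_eq_integral[OF g] g0 by (simp add: ennreal_le_iff)
  have le: "AE z in Q. \<phi> z \<le> ln (f z) + g z - 1"
    using f_pos
  proof (rule AE_mp, intro AE_I2 impI)
    fix z assume "0 < f z"
    then have "\<phi> z - ln (f z) = ln (g z)" by (simp add: g_def ln_div)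
    also have "\<dots> \<le> g z - 1"
      using \<open>0 < f z\<close> by (intro ln_le_minus_one) (simp add: g_def)
    finally show "\<phi> z \<le> ln (f z) + g z - 1" by simp
  qed
  have int: "integrable Q (\<lambda>z. ln (f z) + g z - 1)"
    using KL(2) g by auto
  show \<phi>_int: "integrable Q \<phi>"
  proof (rule Bochner_Integration.integrable_bound)
    show "integrable Q (\<lambda>z. \<bar>b\<bar> + \<bar>ln (f z) + g z - 1\<bar>)"
      using int by auto
    show "AE z in Q. norm (\<phi> z) \<le> norm (\<bar>b\<bar> + \<bar>ln (f z) + g z - 1\<bar>)"
      using le
    proof (rule AE_mp, intro AE_I2 impI)
      fix z assume "\<phi> z \<le> ln (f z) + g z - 1"
      then show "norm (\<phi> z) \<le> norm (\<bar>b\<bar> + \<bar>ln (f z) + g z - 1\<bar>)"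
        using lower[of z] by simp
    qed
  qed measurable
  have "(\<integral>z. \<phi> z \<partial>Q) \<le> (\<integral>z. ln (f z) + g z - 1 \<partial>Q)"
    by (intro integral_mono_AE \<phi>_int int le)
  also have "\<dots> = (\<integral>z. ln (f z) \<partial>Q) + (\<integral>z. g z \<partial>Q) - 1"
    using KL(2) g by (simp add: Q.prob_space)
  finally show "(\<integral>z. \<phi> z \<partial>Q) \<le> a + (\<integral>z. exp (\<phi> z) \<partial>R) - 1"
    using KL(3) g_int by linarith
qed

text \<open>
  The entropy inequality for \<open>t * indicator A\<close> reads \<open>t * Q A \<le> a + (exp t - 1) * R A\<close>. Choose \<open>t\<close>
  large and then \<open>R A\<close> small; the bound depends on \<open>Q\<close> only through \<open>a\<close>.
\<close>

lemma KL_le_uniformly_absolutely_continuous: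
  assumes R: "prob_space R" and "0 < e"
  shows "\<exists>d>0. \<forall>Q A. prob_space Q \<longrightarrow> sets Q = sets R \<longrightarrow> KL Q R \<le> ereal a \<longrightarrow> A \<in> sets R \<longrightarrow>
    measure R A < d \<longrightarrow> measure Q A < e"
proof -
  interpret R: prob_space R by fact
  define t where "t = (\<bar>a\<bar> + 1) / e"
  have t: "t > 0" using \<open>0 < e\<close> by (simp add: t_def)
  show ?thesis
  proof (intro exI[of _ "exp (- t)"] conjI allI impI)
    fix Q A assume Q: "prob_space Q" "sets Q = sets R" "KL Q R \<le> ereal a"
      and A [measurable]: "A \<in> sets R" and small: "measure R A < exp (- t)"
    interpret Q: prob_space Q by fact
    have exp_eq: "exp (t * indicator A z) = 1 + (exp t - 1) * indicator A z" for z
      by (auto simp: indicator_def)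
    have "integrable R (\<lambda>z. exp (t * indicator A z))"
      unfolding exp_eq by (auto simp: R.emeasure_finite less_top[symmetric])
    then have "(\<integral>z. t * indicator A z \<partial>Q) \<le> a + (\<integral>z. exp (t * indicator A z) \<partial>R) - 1"
      using t by (intro entropy_inequality(2)[OF R Q, of _ 0]) (auto simp: indicator_def)
    also have "(\<integral>z. exp (t * indicator A z) \<partial>R) = 1 + (exp t - 1) * measure R A"
      unfolding exp_eq by (subst Bochner_Integration.integral_add) (auto simp: R.prob_space R.emeasure_finite less_top[symmetric])
    also have "(\<integral>z. t * indicator A z \<partial>Q) = t * measure Q A"
      using A Q(2) by simp
    also have "(exp t - 1) * measure R A \<le> exp t * measure R A"
      by (intro mult_right_mono) auto
    also have "exp t * measure R A < exp t * exp (- t)"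
      using small by (intro mult_strict_left_mono) auto
    also have "exp t * exp (- t) = 1"
      by (simp flip: exp_add)
    finally have "t * measure Q A < a + 1" by simp
    also have "\<dots> \<le> t * e" using \<open>0 < e\<close> by (simp add: t_def)
    finally show "measure Q A < e" using t by simp
  qed auto
qed

text \<open>
  Conversely, for an absolutely continuous \<open>Q\<close> the entropy inequality for bounded test functions
  bounds the entropy. The test
  functions are truncations of \<open>ln f\<close> with \<open>f = dQ/dR\<close>. The density is truncated before taking
  the logarithm, since \<open>ln 0 = 0\<close> would make the test function \<open>0\<close>, and not very negative,
  where \<open>f\<close> vanishes.
\<close>

lemma KL_leI:
  assumes R: "prob_space R" and Q: "prob_space Q" and eq: "sets Q = sets R"
    and ac: "absolutely_continuous R Q"
    and test: "\<And>\<phi> b. \<phi> \<in> borel_measurable R \<Longrightarrow> (\<And>z. \<bar>\<phi> z\<bar> \<le> b) \<Longrightarrow>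
      (\<integral>z. \<phi> z \<partial>Q) \<le> a + (\<integral>z. exp (\<phi> z) \<partial>R) - 1"
  shows "KL Q R \<le> ereal a"
proof -
  interpret R: prob_space R by fact
  interpret Q: prob_space Q by fact
  have [measurable_cong]: "sets Q = sets R" by fact
  define f where "f z = enn2real (RN_deriv R Q z)" for z
  have [measurable]: "f \<in> borel_measurable R"
    unfolding f_def by measurable
  have f0: "0 \<le> f z" for z by (simp add: f_def)
  have f_pos: "AE z in Q. 0 < f z"
    unfolding f_def by (rule AE_RN_deriv_pos[OF R Q eq ac])
  have fin: "AE z in R. RN_deriv R Q z \<noteq> \<infinity>"
    using R.RN_deriv_finite[of Q] eq ac Q.sigma_finite_measure_axioms by auto
  have "(\<integral>\<^sup>+ z. ennreal (f z) \<partial>R) = (\<integral>\<^sup>+ z. RN_deriv R Q z * 1 \<partial>R)"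
    using fin by (intro nn_integral_cong_AE) (auto simp: f_def less_top)
  also have "\<dots> = (\<integral>\<^sup>+ z. 1 \<partial>Q)"
    using ac eq by (intro R.RN_deriv_nn_integral[symmetric]) auto
  finally have f_nn: "(\<integral>\<^sup>+ z. ennreal (f z) \<partial>R) = 1"
    by (simp add: Q.emeasure_space_1)
  then have f_int: "integrable R f"
    using f0 by (intro integrableI_bounded) auto
  have f_1: "(\<integral>z. f z \<partial>R) = 1"
    using nn_integral_eq_integral[OF f_int] f0 f_nn by (simp add: ennreal_eq_1)
  define g where "g c k z = min (max (f z) c) (real k + 1)" for c k z
  have [measurable]: "g c k \<in> borel_measurable R" for c k
    unfolding g_def by measurable
  have g_test: "(\<integral>z. ln (g c k z) \<partial>Q) \<le> a + (\<integral>z. g c k z \<partial>R) - 1" if "0 < c" "c \<le> 1" for c k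
  proof -
    have pos: "0 < g c k z" for z using that f0[of z] by (auto simp: g_def)
    have "(\<integral>z. ln (g c k z) \<partial>Q) \<le> a + (\<integral>z. exp (ln (g c k z)) \<partial>R) - 1"
    proof (rule test)
      show "\<bar>ln (g c k z)\<bar> \<le> \<bar>ln c\<bar> + ln (real k + 1)" for z
      proof -
        have "ln c \<le> ln (g c k z)" "ln (g c k z) \<le> ln (real k + 1)" "0 \<le> ln (real k + 1)"
          using that pos[of z] by (auto simp: g_def intro!: ln_ge_zero ln_mono)
        then show ?thesis by linarith
      qed
    qed measurable
    then show ?thesis using pos by simp
  qed
  have g_le: "g c k z \<le> f z + c" "0 \<le> g c k z" if "0 < c" for c k z
    using that f0[of z] by (auto simp: g_def)
  have g_int: "integrable R (g c k)" if "0 < c" for c k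
    by (rule Bochner_Integration.integrable_bound[of R "\<lambda>z. f z + c"])
       (use f_int g_le[OF that] in \<open>auto intro!: AE_I2 intro: order_trans[OF _ abs_ge_self]\<close>)
  \<comment> \<open>The positive part of the log-density is integrable.\<close>
  have pos: "(\<integral>\<^sup>+ z. ennreal (ln (f z)) \<partial>Q) \<le> ennreal (a + 1)"
  proof -
    have lim: "(\<lambda>k. ennreal (ln (g 1 k z))) \<longlonglongrightarrow> ennreal (ln (f z))" if "0 < f z" for z
    proof -
      obtain n where n: "f z \<le> real n" using real_arch_simple by blast
      have "eventually (\<lambda>k. ennreal (ln (g 1 k z)) = ennreal (ln (f z))) sequentially"
        using eventually_ge_at_top[of n]
      proof eventually_elim
        case (elim k)
        then have "g 1 k z = max (f z) 1" using n by (auto simp: g_def)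
        then show ?case using that by (auto simp: max_def ennreal_neg)
      qed
      then show ?thesis by (rule tendsto_eventually)
    qed
    have "(\<integral>\<^sup>+ z. ennreal (ln (f z)) \<partial>Q) = (\<integral>\<^sup>+ z. liminf (\<lambda>k. ennreal (ln (g 1 k z))) \<partial>Q)"
      using f_pos by (intro nn_integral_cong_AE) (auto simp: lim_imp_Liminf[OF _ lim])
    also have "\<dots> \<le> liminf (\<lambda>k. \<integral>\<^sup>+ z. ennreal (ln (g 1 k z)) \<partial>Q)"
      by (rule nn_integral_liminf) auto
    also have "\<dots> \<le> ennreal (a + 1)"
    proof (rule Liminf_le)
      show "\<forall>\<^sub>F k in sequentially. (\<integral>\<^sup>+ z. ennreal (ln (g 1 k z)) \<partial>Q) \<le> ennreal (a + 1)"
      proof (intro always_eventually allI)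
        fix k
        have ge1: "1 \<le> g 1 k z" for z by (auto simp: g_def)
        have "integrable Q (\<lambda>z. ln (g 1 k z))"
        proof (rule Q.integrable_const_bound[of _ "ln (real k + 1)"])
          show "AE z in Q. norm (ln (g 1 k z)) \<le> ln (real k + 1)"
          proof (rule AE_I2)
            fix z
            have "ln (g 1 k z) \<le> ln (real k + 1)"
              using ge1[of z] by (intro ln_mono) (auto simp: g_def)
            then show "norm (ln (g 1 k z)) \<le> ln (real k + 1)"
              using ge1[of z] by simp
          qed
        qed measurable
        then have "(\<integral>\<^sup>+ z. ennreal (ln (g 1 k z)) \<partial>Q) = ennreal (\<integral>z. ln (g 1 k z) \<partial>Q)"
          using ge1 by (intro nn_integral_eq_integral) auto
        also have "(\<integral>z. ln (g 1 k z) \<partial>Q) \<le> a + (\<integral>z. g 1 k z \<partial>R) - 1"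
          by (intro g_test) auto
        also have "(\<integral>z. g 1 k z \<partial>R) \<le> (\<integral>z. f z + 1 \<partial>R)"
          using g_le[of 1] f_int g_int[of 1] by (intro integral_mono) auto
        also have "\<dots> = 2" using f_int by (simp add: f_1 R.prob_space)
        finally show "(\<integral>\<^sup>+ z. ennreal (ln (g 1 k z)) \<partial>Q) \<le> ennreal (a + 1)"
          by (simp add: ennreal_leI add.commute)
      qed
    qed simp
    finally show ?thesis .
  qed
  have eq_ed: "entropy_density (exp 1) R Q = (\<lambda>z. ln (f z))"
    by (auto simp: entropy_density_def log_def fun_eq_iff f_def)
  have neg: "(\<integral>\<^sup>+ z. ennreal (- ln (f z)) \<partial>Q) \<le> 1"
    using nn_integral_neg_entropy_density_finite[OF Q R eq ac] by (simp add: eq_ed)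
  have int: "integrable Q (\<lambda>z. ln (f z))"
    unfolding real_integrable_def using pos neg by (auto simp: top_unique)
  \<comment> \<open>Now the lower truncation level \<open>c k\<close> tends to \<open>0\<close> while the upper one tends to infinity.\<close>
  have "(\<integral>z. ln (f z) \<partial>Q) \<le> a"
  proof (rule LIMSEQ_le)
    define c where "c k = 1 / (real k + 1)" for k :: nat
    have c: "0 < c k" "c k \<le> 1" for k by (auto simp: c_def)
    have g_lim: "(\<lambda>k. g (c k) k z) \<longlonglongrightarrow> f z" for z
    proof -
      have "(\<lambda>k. max (f z) (c k)) \<longlonglongrightarrow> max (f z) 0"
        unfolding c_def by (intro tendsto_max tendsto_const) real_asymp
      moreover have "eventually (\<lambda>k. max (f z) (c k) = g (c k) k z) sequentially"
      proof -
        obtain n where n: "f z \<le> real n" using real_arch_simple by blast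
        show ?thesis
          using eventually_ge_at_top[of n]
        proof eventually_elim
          case (elim k)
          then show ?case using n c[of k] by (auto simp: g_def)
        qed
      qed
      ultimately show ?thesis using f0[of z] by (simp add: tendsto_cong)
    qed
    show "(\<lambda>k. \<integral>z. ln (g (c k) k z) \<partial>Q) \<longlonglongrightarrow> (\<integral>z. ln (f z) \<partial>Q)"
    proof (rule integral_dominated_convergence[where w = "\<lambda>z. \<bar>ln (f z)\<bar>"])
      show "AE z in Q. (\<lambda>k. ln (g (c k) k z)) \<longlonglongrightarrow> ln (f z)"
        using f_pos by (rule AE_mp) (auto intro!: AE_I2 tendsto_ln g_lim)
      show "AE z in Q. norm (ln (g (c k) k z)) \<le> \<bar>ln (f z)\<bar>" for k
        using f_pos
      proof (rule AE_mp, intro AE_I2 impI)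
        fix z assume f: "0 < f z"
        consider "g (c k) k z = f z" | "f z \<le> g (c k) k z" "0 < g (c k) k z" "g (c k) k z \<le> 1"
          | "g (c k) k z \<le> f z" "1 \<le> g (c k) k z"
          using c[of k] by (force simp: g_def)
        then show "norm (ln (g (c k) k z)) \<le> \<bar>ln (f z)\<bar>"
        proof cases
          case 2
          then have "ln (f z) \<le> ln (g (c k) k z)" "ln (g (c k) k z) \<le> 0" using f by auto
          then show ?thesis by simp
        next
          case 3
          then have "ln (g (c k) k z) \<le> ln (f z)" "0 \<le> ln (g (c k) k z)" by auto
          then show ?thesis by simp
        qed simp
      qed
    qed (use int in auto)
    have "(\<lambda>k. \<integral>z. g (c k) k z \<partial>R) \<longlonglongrightarrow> (\<integral>z. f z \<partial>R)"
    proof (rule integral_dominated_convergence[where w = "\<lambda>z. f z + 1"])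
      show "AE z in R. norm (g (c k) k z) \<le> f z + 1" for k
        using g_le[OF c(1)[of k]] c(2)[of k] by (intro AE_I2) (smt (verit) real_norm_def)
    qed (use f_int g_lim in auto)
    then have "(\<lambda>k. a + (\<integral>z. g (c k) k z \<partial>R) - 1) \<longlonglongrightarrow> a + 1 - 1"
      unfolding f_1 by (intro tendsto_intros)
    then show "(\<lambda>k. a + (\<integral>z. g (c k) k z \<partial>R) - 1) \<longlonglongrightarrow> a" by simp
    show "\<exists>N. \<forall>k\<ge>N. (\<integral>z. ln (g (c k) k z) \<partial>Q) \<le> a + (\<integral>z. g (c k) k z \<partial>R) - 1"
      using g_test c by blast
  qed
  then show ?thesis
    using ac int by (simp add: KL_def KL_divergence_def eq_ed)
qed

section \<open>Setwise convergence\<close>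

lemma uniform_continuity_at_empty:
  fixes Q :: "nat \<Rightarrow> 'a measure"
  assumes "finite_measure R"
    and uac: "\<And>e. 0 < e \<Longrightarrow> \<exists>d>0. \<forall>n. \<forall>A\<in>sets R. measure R A < d \<longrightarrow> measure (Q n) A < e"
    and A: "range A \<subseteq> sets R" "decseq A" "(\<Inter>i. A i) = {}" and "0 < e"
  shows "\<exists>N. \<forall>n. measure (Q n) (A N) < e"
proof -
  interpret finite_measure R by fact
  obtain d where d: "0 < d" "\<And>n A. A \<in> sets R \<Longrightarrow> measure R A < d \<Longrightarrow> measure (Q n) A < e"
    using uac[OF \<open>0 < e\<close>] by blast
  have "(\<lambda>i. measure R (A i)) \<longlonglongrightarrow> 0"
    using finite_Lim_measure_decseq[OF A(1,2)] A(3) by simp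
  then have "\<forall>\<^sub>F i in sequentially. measure R (A i) < d"
    using d(1) by (rule order_tendstoD(2))
  then obtain N where "measure R (A N) < d"
    by (auto simp: eventually_sequentially)
  then show ?thesis
    using d(2) A(1) by (intro exI[of _ N]) auto
qed

text \<open>
  Finite intersections of sets from a countable base; the empty intersection is the whole space.
\<close>

lemma countable_Int_stable_generator_borel:
  obtains E :: "'a::second_countable_topology set set"
  where "countable E" "E \<noteq> {}" "Int_stable E" "sets borel = sigma_sets UNIV E"
proof -
  obtain B :: "'a set set" where B: "countable B" "topological_basis B"
    using ex_countable_basis by blast
  define E where "E = Inter ` {F. finite F \<and> F \<subseteq> B}"
  have "countable E"
    unfolding E_def using countable_Collect_finite_subset[OF B(1)] by (intro countable_image) simp
  moreover have "E \<noteq> {}" unfolding E_def by auto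
  moreover have "Int_stable E"
  proof (rule Int_stableI)
    fix a b assume "a \<in> E" "b \<in> E"
    then obtain F G where "a = \<Inter>F" "b = \<Inter>G" "finite F" "F \<subseteq> B" "finite G" "G \<subseteq> B"
      by (auto simp: E_def)
    then show "a \<inter> b \<in> E"
      unfolding E_def by (intro image_eqI[of _ _ "F \<union> G"]) auto
  qed
  moreover have "topological_basis E"
  proof -
    have "open U" if "U \<in> E" for U
      using that topological_basis_open[OF B(2)] by (auto simp: E_def intro!: open_Inter)
    moreover have "B \<subseteq> E"
    proof
      fix U assume "U \<in> B"
      then show "U \<in> E" unfolding E_def by (intro image_eqI[of _ _ "{U}"]) auto
    qed
    ultimately show ?thesis
      using B(2) unfolding topological_basis_def by (meson order_trans)
  qed
  then have "borel = sigma UNIV E"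
    using \<open>countable E\<close> by (intro second_countable_borel_measurable topological_basis_imp_subbasis)
  then have "sets borel = sigma_sets UNIV E"
    by (metis Pow_UNIV sets_measure_of subset_UNIV)
  ultimately show ?thesis using that by blast
qed

lemma diagonal_convergent_subsequence:
  fixes x :: "'b \<Rightarrow> nat \<Rightarrow> real"
  assumes "countable E" "E \<noteq> {}" and bounded: "\<And>A n. A \<in> E \<Longrightarrow> \<bar>x A n\<bar> \<le> b"
  obtains r where "strict_mono r" "\<And>A. A \<in> E \<Longrightarrow> convergent (\<lambda>n. x A (r n))"
proof -
  define e where "e = from_nat_into E"
  have e: "range e = E"
    unfolding e_def using assms by (simp add: range_from_nat_into)
  interpret subseqs "\<lambda>i s. convergent (\<lambda>n. x (e i) (s n))"
  proof
    fix i and s :: "nat \<Rightarrow> nat"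
    have "bounded (range (\<lambda>n. x (e i) (s n)))"
      using bounded e by (intro boundedI[of _ b]) auto
    then obtain l r where "strict_mono r" "((\<lambda>n. x (e i) (s n)) \<circ> r) \<longlonglongrightarrow> l"
      using bounded_imp_convergent_subsequence by blast
    then show "\<exists>r. strict_mono r \<and> convergent (\<lambda>n. x (e i) ((s \<circ> r) n))"
      by (auto simp: convergent_def comp_def)
  qed
  have "convergent (\<lambda>n. x (e i) (diagseq n))" for i
  proof -
    have "convergent (\<lambda>n. x (e i) ((diagseq \<circ> (+) (Suc i)) n))"
    proof (rule diagseq_holds)
      fix r s :: "nat \<Rightarrow> nat" and n
      assume "strict_mono r" "convergent (\<lambda>k. x (e n) (s k))"
      then show "convergent (\<lambda>k. x (e n) ((s \<circ> r) k))"
        using convergent_subseq_convergent[of "\<lambda>k. x (e n) (s k)" r] by (simp add: comp_def)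
    qed
    then have "convergent (\<lambda>n. x (e i) (diagseq (n + Suc i)))"
      by (simp add: comp_def add.commute)
    then show ?thesis
      using convergent_ignore_initial_segment[of "\<lambda>n. x (e i) (diagseq n)" "Suc i"] by simp
  qed
  then show ?thesis
    using that[OF subseq_diagseq] e by blast
qed

text \<open>
  Setwise sequential compactness of a uniformly absolutely continuous sequence. Convergence on
  a countable generator comes from a diagonal argument; uniform absolute continuity makes the
  sets on which the masses converge a Dynkin system and makes the limit countably additive.
\<close>

lemma setwise_convergent_subsequence:
  fixes Q :: "nat \<Rightarrow> 'a::second_countable_topology measure"
  assumes R: "finite_measure R" "sets R = sets borel"
    and Q: "\<And>n. prob_space (Q n)" "\<And>n. sets (Q n) = sets borel"
    and uac: "\<And>e. 0 < e \<Longrightarrow> \<exists>d>0. \<forall>n. \<forall>A\<in>sets R. measure R A < d \<longrightarrow> measure (Q n) A < e"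
  obtains r q where "strict_mono r" "prob_space q" "sets q = sets borel"
    "\<And>A. A \<in> sets borel \<Longrightarrow> (\<lambda>n. measure (Q (r n)) A) \<longlonglongrightarrow> measure q A"
proof -
  obtain E :: "'a set set" where E: "countable E" "E \<noteq> {}" "Int_stable E" "sets borel = sigma_sets UNIV E"
    using countable_Int_stable_generator_borel by blast
  have le1: "measure (Q n) A \<le> 1" for n A
    using Q(1) by (rule prob_space.prob_le_1)
  have space: "space (Q n) = UNIV" for n
    using sets_eq_imp_space_eq[OF Q(2)] by simp
  have one: "measure (Q n) UNIV = 1" for n
    using prob_space.prob_space[OF Q(1)[of n]] by (simp add: space)
  have add: "measure (Q n) (A \<union> B) = measure (Q n) A + measure (Q n) B"
    if "A \<in> sets borel" "B \<in> sets borel" "A \<inter> B = {}" for n A B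
    using that Q by (intro finite_measure.finite_measure_Union) (auto simp: prob_space_def)
  obtain r where r: "strict_mono r" "\<And>A. A \<in> E \<Longrightarrow> convergent (\<lambda>n. measure (Q (r n)) A)"
    using diagonal_convergent_subsequence[OF E(1,2), of "\<lambda>A n. measure (Q n) A" 1] le1 by auto
  have small: "\<exists>N. \<forall>n. measure (Q n) (A N) < e"
    if "range A \<subseteq> sets borel" "decseq A" "(\<Inter>i. A i) = {}" "0 < e" for A e
    using uniform_continuity_at_empty[OF R(1) uac, of A e] that R(2) by auto
  have conv: "convergent (\<lambda>n. measure (Q (r n)) A)" if "A \<in> sets borel" for A
  proof -
    have "E \<subseteq> Pow UNIV" "A \<in> sigma_sets UNIV E"
      using that E(4) by simp_all
    with E(3) show ?thesis
    proof (induction rule: sigma_sets_induct_disjoint)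
      case (compl A)
      then have "measure (Q (r n)) (UNIV - A) = 1 - measure (Q (r n)) A" for n
        using compl.hyps prob_space.prob_compl[OF Q(1), of A "r n"] by (simp add: Q(2) E(4) space)
      then show ?case
        using convergent_diff[OF convergent_const[of 1] compl.IH] by simp
    next
      case (union A)
      have A: "A i \<in> sets borel" for i using union.hyps(2) E(4) by auto
      show ?case
      proof (rule Cauchy_convergent, rule CauchyI)
        fix e :: real assume "0 < e"
        define T where "T N = (\<Union>i\<in>{N..}. A i)" for N
        have T: "T N \<in> sets borel" for N using A by (auto simp: T_def)
        have "(\<Inter>N. T N) = {}"
        proof (intro equalityI subsetI)
          fix z assume "z \<in> (\<Inter>N. T N)"
          then have *: "\<exists>i\<ge>N. z \<in> A i" for N by (auto simp: T_def)
          then obtain i where i: "z \<in> A i" by blast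
          obtain j where "j \<ge> Suc i" "z \<in> A j" using * by blast
          then have "A i \<inter> A j = {}" using union.hyps(1) by (auto simp: disjoint_family_on_def)
          then show "z \<in> {}" using i \<open>z \<in> A j\<close> by auto
        qed simp
        moreover have "decseq T"
          by (rule decseq_SucI) (force simp: T_def)
        ultimately obtain N where N: "\<And>n. measure (Q n) (T N) < e / 3"
          using small[of T "e / 3"] T \<open>0 < e\<close> by auto
        have split: "measure (Q n) (\<Union>i. A i) = (\<Sum>i<N. measure (Q n) (A i)) + measure (Q n) (T N)" for n
        proof -
          have "(\<Union>i. A i) = (\<Union>i<N. A i) \<union> T N"
            by (auto simp: T_def) (metis atLeast_iff lessThan_iff linorder_not_le)
          moreover have "(\<Union>i<N. A i) \<inter> T N = {}"
          proof -
            have "A i \<inter> A j = {}" if "i < N" "N \<le> j" for i j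
              using union.hyps(1) that by (simp add: disjoint_family_on_def)
            then show ?thesis unfolding T_def by blast
          qed
          moreover have "(\<Union>i<N. A i) \<in> sets borel" using A by auto
          moreover have "measure (Q n) (\<Union>i<N. A i) = (\<Sum>i<N. measure (Q n) (A i))"
            using A Q union.hyps(1)
            by (intro finite_measure.finite_measure_finite_Union)
               (auto simp: prob_space_def disjoint_family_on_def)
          ultimately show ?thesis using add T by simp
        qed
        have "convergent (\<lambda>n. \<Sum>i<N. measure (Q (r n)) (A i))"
          by (intro convergent_sum union.IH)
        then have "Cauchy (\<lambda>n. \<Sum>i<N. measure (Q (r n)) (A i))"
          by (rule convergent_Cauchy)
        then obtain M where M: "\<And>m n. m \<ge> M \<Longrightarrow> n \<ge> M \<Longrightarrow>
          norm ((\<Sum>i<N. measure (Q (r m)) (A i)) - (\<Sum>i<N. measure (Q (r n)) (A i))) < e / 3"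
          using \<open>0 < e\<close> CauchyD[of _ "e / 3"] by (meson divide_pos_pos zero_less_numeral)
        show "\<exists>M. \<forall>m\<ge>M. \<forall>n\<ge>M. norm (measure (Q (r m)) (\<Union>i. A i) - measure (Q (r n)) (\<Union>i. A i)) < e"
        proof (intro exI[of _ M] allI impI)
          fix m n assume "m \<ge> M" "n \<ge> M"
          then have "norm ((\<Sum>i<N. measure (Q (r m)) (A i)) - (\<Sum>i<N. measure (Q (r n)) (A i))) < e / 3"
            by (rule M)
          then show "norm (measure (Q (r m)) (\<Union>i. A i) - measure (Q (r n)) (\<Union>i. A i)) < e"
            unfolding split using N[of "r m"] N[of "r n"]
              measure_nonneg[of "Q (r m)" "T N"] measure_nonneg[of "Q (r n)" "T N"]
            unfolding real_norm_def by linarith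
        qed
      qed
    qed (use r in \<open>auto simp: convergent_const\<close>)
  qed
  define L where "L A = lim (\<lambda>n. measure (Q (r n)) A)" for A
  have L: "(\<lambda>n. measure (Q (r n)) A) \<longlonglongrightarrow> L A" if "A \<in> sets borel" for A
    using conv[OF that] by (simp add: L_def convergent_LIMSEQ_iff)
  have L0: "0 \<le> L A" if "A \<in> sets borel" for A
    using L[OF that] by (rule LIMSEQ_le_const) auto
  have L_add: "L (A \<union> B) = L A + L B" if "A \<in> sets borel" "B \<in> sets borel" "A \<inter> B = {}" for A B
  proof (rule LIMSEQ_unique)
    show "(\<lambda>n. measure (Q (r n)) (A \<union> B)) \<longlonglongrightarrow> L (A \<union> B)"
      using that by (intro L) auto
    show "(\<lambda>n. measure (Q (r n)) (A \<union> B)) \<longlonglongrightarrow> L A + L B"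
      unfolding add[OF that] using that by (intro tendsto_add L)
  qed
  have L_UNIV: "L UNIV = 1"
    using LIMSEQ_unique[OF L[of UNIV]] by (simp add: one)
  have L_empty: "L {} = 0"
    using LIMSEQ_unique[OF L[of "{}"]] by simp
  have ca: "countably_additive (sets borel) (\<lambda>A. ennreal (L A))"
  proof (rule ring_of_sets.empty_continuous_imp_countably_additive)
    show "ring_of_sets UNIV (sets (borel :: 'a measure))"
      by (metis sets.ring_of_sets_axioms space_borel)
    show "positive (sets borel) (\<lambda>A. ennreal (L A))"
      by (simp add: positive_def L_empty)
    show "additive (sets borel) (\<lambda>A. ennreal (L A))"
      by (auto simp: additive_def L_add L0)
    fix A :: "nat \<Rightarrow> 'a set"
    assume A: "range A \<subseteq> sets borel" "decseq A" "(\<Inter>i. A i) = {}"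
    have "(\<lambda>i. L (A i)) \<longlonglongrightarrow> 0"
    proof (rule LIMSEQ_I)
      fix e :: real assume "0 < e"
      then obtain N where N: "\<And>n. measure (Q n) (A N) < e / 2"
        using small[OF A, of "e / 2"] by auto
      show "\<exists>N. \<forall>i\<ge>N. norm (L (A i) - 0) < e"
      proof (intro exI[of _ N] allI impI)
        fix i assume "N \<le> i"
        have "measure (Q (r n)) (A i) \<le> e / 2" for n
        proof -
          have "measure (Q (r n)) (A i) \<le> measure (Q (r n)) (A N)"
            using A Q \<open>N \<le> i\<close>
            by (intro finite_measure.finite_measure_mono) (auto simp: prob_space_def decseq_def)
          then show ?thesis using N[of "r n"] by simp
        qed
        then have "L (A i) \<le> e / 2"
          using A by (intro LIMSEQ_le_const2[OF L]) auto
        then show "norm (L (A i) - 0) < e"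
          using L0[of "A i"] A \<open>0 < e\<close> by auto
      qed
    qed
    then show "(\<lambda>i. ennreal (L (A i))) \<longlonglongrightarrow> 0"
      using tendsto_ennrealI[of _ 0] by simp
  qed auto
  define q where "q = measure_of UNIV (sets borel) (\<lambda>A. ennreal (L A))"
  have q_sets: "sets q = sets borel"
    unfolding q_def using sets.sigma_sets_eq[of "borel :: 'a measure"] by (simp add: sets_measure_of)
  have q: "emeasure q A = ennreal (L A)" if "A \<in> sets borel" for A
    unfolding q_def
    using ca that sets.sigma_algebra_axioms[of "borel :: 'a measure"]
    by (intro emeasure_measure_of_sigma) (auto simp: positive_def L_empty)
  have "prob_space q"
    using sets_eq_imp_space_eq[OF q_sets] by (intro prob_spaceI) (simp add: q L_UNIV)
  moreover have "(\<lambda>n. measure (Q (r n)) A) \<longlonglongrightarrow> measure q A" if "A \<in> sets borel" for A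
    using L[OF that] q[OF that] L0[OF that] by (simp add: measure_def)
  ultimately show ?thesis using that r(1) q_sets by blast
qed

text \<open>
  A bounded function is uniformly close to one with finitely many values, obtained by rounding
  down to multiples of \<open>1 / m\<close>.
\<close>

lemma setwise_tendsto_integral:
  fixes \<phi> :: "'a \<Rightarrow> real"
  assumes Q: "\<And>n::nat. prob_space (Q n)" "\<And>n. sets (Q n) = sets M"
    and q: "prob_space q" "sets q = sets M"
    and lim: "\<And>A. A \<in> sets M \<Longrightarrow> (\<lambda>n. measure (Q n) A) \<longlonglongrightarrow> measure q A"
    and \<phi> [measurable]: "\<phi> \<in> borel_measurable M" and b: "\<And>z. \<bar>\<phi> z\<bar> \<le> b"
  shows "(\<lambda>n. \<integral>z. \<phi> z \<partial>Q n) \<longlonglongrightarrow> (\<integral>z. \<phi> z \<partial>q)"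
proof (rule LIMSEQ_I)
  fix e :: real assume "0 < e"
  then obtain i where "inverse (real (Suc i)) < e / 3"
    using reals_Archimedean[of "e / 3"] by auto
  then obtain m :: nat where m: "0 < m" "1 / real m < e / 3"
    using that[of "Suc i"] by (simp add: inverse_eq_divide)
  define c where "c z = \<lfloor>real m * \<phi> z\<rfloor>" for z
  define J where "J = {\<lfloor>- real m * b\<rfloor>..\<lfloor>real m * b\<rfloor>}"
  have c_J: "c z \<in> J" for z
  proof -
    have "- real m * b \<le> real m * \<phi> z" "real m * \<phi> z \<le> real m * b"
      using b[of z] mult_left_mono[of "- b" "\<phi> z" "real m"] mult_left_mono[of "\<phi> z" b "real m"] by auto
    then show ?thesis unfolding c_def J_def by (auto intro: floor_mono)
  qed
  have [measurable]: "c \<in> M \<rightarrow>\<^sub>M count_space UNIV"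
    unfolding c_def by measurable
  define s where "s P = (\<Sum>j\<in>J. of_int j / real m * measure P {z \<in> space M. c z = j})" for P
  have approx: "\<bar>(\<integral>z. \<phi> z \<partial>P) - s P\<bar> \<le> 1 / real m" if P: "prob_space P" "sets P = sets M" for P
  proof -
    interpret prob_space P by fact
    have [measurable_cong]: "sets P = sets M" by fact
    have sp: "space P = space M" using P(2) by (rule sets_eq_imp_space_eq)
    have s: "has_bochner_integral P (\<lambda>z. of_int (c z) / real m) (s P)"
      using has_bochner_integral_finite_valued[OF finite_measure_axioms, of c J "\<lambda>j. of_int j / real m"] c_J
      by (simp add: s_def sp J_def)
    have \<phi>_int: "integrable P \<phi>"
      using b by (intro integrable_const_bound[of _ b]) auto
    have pt: "\<bar>\<phi> z - of_int (c z) / real m\<bar> \<le> 1 / real m" for z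
    proof -
      have "of_int (c z) \<le> real m * \<phi> z" "real m * \<phi> z \<le> of_int (c z) + 1"
        unfolding c_def by linarith+
      then have "\<bar>(real m * \<phi> z - of_int (c z)) / real m\<bar> \<le> 1 / real m"
        using m(1) by (simp add: abs_divide divide_right_mono)
      then show ?thesis using m(1) by (simp add: diff_divide_distrib)
    qed
    have "\<bar>(\<integral>z. \<phi> z \<partial>P) - s P\<bar> = \<bar>\<integral>z. \<phi> z - of_int (c z) / real m \<partial>P\<bar>"
      using s \<phi>_int by (simp add: has_bochner_integral_iff)
    also have "\<dots> \<le> (\<integral>z. \<bar>\<phi> z - of_int (c z) / real m\<bar> \<partial>P)"
      by (rule integral_abs_bound)
    also have "\<dots> \<le> (\<integral>z. 1 / real m \<partial>P)"
      using s \<phi>_int pt by (intro integral_mono) (auto simp: has_bochner_integral_iff)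
    finally show ?thesis by (simp add: prob_space)
  qed
  have "(\<lambda>n. s (Q n)) \<longlonglongrightarrow> s q"
    unfolding s_def by (intro tendsto_sum tendsto_mult_left lim) measurable
  from LIMSEQ_D[OF this, of "e / 3"] \<open>0 < e\<close>
  obtain N where N: "\<And>n. n \<ge> N \<Longrightarrow> \<bar>s (Q n) - s q\<bar> < e / 3"
    by auto
  show "\<exists>N. \<forall>n\<ge>N. norm ((\<integral>z. \<phi> z \<partial>Q n) - (\<integral>z. \<phi> z \<partial>q)) < e"
  proof (intro exI[of _ N] allI impI)
    fix n assume "n \<ge> N"
    show "norm ((\<integral>z. \<phi> z \<partial>Q n) - (\<integral>z. \<phi> z \<partial>q)) < e"
      using N[OF \<open>n \<ge> N\<close>] approx[OF Q(1,2), of n] approx[OF q] m(2)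
      unfolding real_norm_def by linarith
  qed
qed

text \<open>
  Lower semicontinuity of the entropy: both sides of the entropy inequality for a bounded test
  function pass to the setwise limit.
\<close>

lemma KL_le_setwise_limit:
  assumes R: "prob_space R" and Q: "\<And>n::nat. prob_space (Q n)" "\<And>n. sets (Q n) = sets R"
    and q: "prob_space q" "sets q = sets R"
    and lim: "\<And>A. A \<in> sets R \<Longrightarrow> (\<lambda>n. measure (Q n) A) \<longlonglongrightarrow> measure q A"
    and KL: "\<And>n. KL (Q n) R \<le> ereal a"
  shows "KL q R \<le> ereal a"
proof (rule KL_leI[OF R q])
  interpret R: prob_space R by fact
  interpret q: prob_space q by fact
  show "absolutely_continuous R q"
    unfolding absolutely_continuous_def
  proof
    fix A assume A: "A \<in> null_sets R"
    have "A \<in> null_sets (Q n)" for n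
      using KL_leD(1)[OF KL[of n]] A by (auto simp: absolutely_continuous_def)
    then have "measure (Q n) A = 0" for n
      by (simp add: measure_def null_setsD1)
    then have "measure q A = 0"
      using LIMSEQ_unique[OF lim[of A], of 0] A by auto
    then show "A \<in> null_sets q"
      using A q(2) by (intro null_setsI) (auto simp: q.emeasure_eq_measure)
  qed
  fix \<phi> :: "_ \<Rightarrow> real" and b
  assume [measurable]: "\<phi> \<in> borel_measurable R" and b: "\<And>z. \<bar>\<phi> z\<bar> \<le> b"
  have "(\<lambda>n. \<integral>z. \<phi> z \<partial>Q n) \<longlonglongrightarrow> (\<integral>z. \<phi> z \<partial>q)"
    by (rule setwise_tendsto_integral[OF Q q lim _ b]) auto
  moreover have "(\<integral>z. \<phi> z \<partial>Q n) \<le> a + (\<integral>z. exp (\<phi> z) \<partial>R) - 1" for n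
  proof (rule entropy_inequality(2)[OF R Q KL])
    show "- b \<le> \<phi> z" for z using b[of z] by linarith
    have "\<phi> z \<le> b" for z using b[of z] by linarith
    then show "integrable R (\<lambda>z. exp (\<phi> z))"
      by (intro R.integrable_const_bound[of _ "exp b"]) auto
  qed measurable
  ultimately show "(\<integral>z. \<phi> z \<partial>q) \<le> a + (\<integral>z. exp (\<phi> z) \<partial>R) - 1"
    by (intro LIMSEQ_le_const2) auto
qed

section \<open>Convergence in transport distance\<close>

text \<open>
  Exponential moments of all orders make \<open>2 + norm x\<close>, which dominates the distance to \<open>0\<close>,
  uniformly integrable over an entropy ball: the entropy inequality is applied to a large multiple
  of this function, cut off to a set of small mass.
\<close>

lemma KL_le_uniformly_integrable:
  fixes R :: "('dx::finite, 'dy::finite) pt measure"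
  assumes R: "prob_space R" "sets R = sets borel"
    and exp: "\<And>\<alpha>. 0 < \<alpha> \<Longrightarrow> integrable R (\<lambda>z. exp (\<alpha> * (2 + norm (fst (snd z)))))"
    and B: "\<And>N. B N \<in> sets borel" "\<And>z. \<forall>\<^sub>F N in sequentially. z \<notin> B N" and "0 < e"
  shows "\<exists>N. \<forall>Q. prob_space Q \<longrightarrow> sets Q = sets borel \<longrightarrow> KL Q R \<le> ereal a \<longrightarrow>
    (\<integral>\<^sup>+ z. ennreal ((2 + norm (fst (snd z))) * indicator (B N) z) \<partial>Q) \<le> ennreal e"
proof -
  interpret R: prob_space R by fact
  have [measurable_cong]: "sets R = sets borel" by fact
  note [measurable] = B(1)
  \<comment> \<open>With this \<open>\<alpha>\<close>, a right-hand side of at most \<open>a + 1\<close> in the entropy inequality suffices.\<close>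
  define \<alpha> where "\<alpha> = (\<bar>a\<bar> + 1) / e"
  have \<alpha>: "0 < \<alpha>" using \<open>0 < e\<close> by (simp add: \<alpha>_def)
  define g where "g z = 2 + norm (fst (snd z))" for z :: "('dx, 'dy) pt"
  have [measurable]: "g \<in> borel_measurable borel"
    unfolding g_def by measurable
  have g0: "0 \<le> g z" for z by (simp add: g_def)
  have g_exp: "integrable R (\<lambda>z. exp (\<alpha> * g z))"
    using exp[OF \<alpha>] by (simp add: g_def)
  have "(\<lambda>N. \<integral>z. exp (\<alpha> * g z) * indicator (B N) z \<partial>R) \<longlonglongrightarrow> (\<integral>z. 0 \<partial>R)"
  proof (rule integral_dominated_convergence[where w = "\<lambda>z. exp (\<alpha> * g z)"])
    show "AE z in R. (\<lambda>N. exp (\<alpha> * g z) * indicator (B N) z) \<longlonglongrightarrow> 0"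
    proof (rule AE_I2)
      fix z
      have "\<forall>\<^sub>F N in sequentially. exp (\<alpha> * g z) * indicator (B N) z = 0"
        using B(2)[of z] by eventually_elim simp
      then show "(\<lambda>N. exp (\<alpha> * g z) * indicator (B N) z) \<longlonglongrightarrow> 0"
        by (rule tendsto_eventually)
    qed
  qed (use g_exp in \<open>auto simp: indicator_def\<close>)
  then have "\<forall>\<^sub>F N in sequentially. (\<integral>z. exp (\<alpha> * g z) * indicator (B N) z \<partial>R) < 1"
    by (intro order_tendstoD(2)) auto
  then obtain N where N: "(\<integral>z. exp (\<alpha> * g z) * indicator (B N) z \<partial>R) < 1"
    by (auto simp: eventually_sequentially)
  have int: "integrable R (\<lambda>z. 1 + exp (\<alpha> * g z) * indicator (B N) z)"
    using g_exp by (intro Bochner_Integration.integrable_add integrable_real_mult_indicator) auto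
  have exp_le: "exp (\<alpha> * (g z * indicator (B N) z)) \<le> 1 + exp (\<alpha> * g z) * indicator (B N) z" for z
    by (simp add: indicator_def)
  have int': "integrable R (\<lambda>z. exp (\<alpha> * (g z * indicator (B N) z)))"
    by (rule Bochner_Integration.integrable_bound[OF int])
       (auto intro!: AE_I2 simp: indicator_def)
  show ?thesis
    unfolding g_def[symmetric]
  proof (intro exI[of _ N] allI impI)
    fix Q assume Q: "prob_space Q" "sets Q = sets borel" and KL: "KL Q R \<le> ereal a"
    interpret Q: prob_space Q by fact
    have [measurable_cong]: "sets Q = sets borel" by fact
    have sets: "sets Q = sets R" using Q R by simp
    note ent = entropy_inequality[OF R(1) Q(1) sets KL _ _ int', of 0]
    have ent_int: "integrable Q (\<lambda>z. \<alpha> * (g z * indicator (B N) z))"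
      using \<alpha> g0 by (intro ent) auto
    have "(\<integral>z. \<alpha> * (g z * indicator (B N) z) \<partial>Q) \<le> a + (\<integral>z. exp (\<alpha> * (g z * indicator (B N) z)) \<partial>R) - 1"
      using \<alpha> g0 by (intro ent) auto
    also have "(\<integral>z. exp (\<alpha> * (g z * indicator (B N) z)) \<partial>R) \<le> (\<integral>z. 1 + exp (\<alpha> * g z) * indicator (B N) z \<partial>R)"
      by (intro integral_mono int int' exp_le)
    also have "\<dots> = 1 + (\<integral>z. exp (\<alpha> * g z) * indicator (B N) z \<partial>R)"
      using g_exp by (subst Bochner_Integration.integral_add) (auto simp: R.prob_space intro!: integrable_real_mult_indicator)
    also have "\<dots> \<le> 2" using N by simp
    finally have "\<alpha> * (\<integral>z. g z * indicator (B N) z \<partial>Q) \<le> a + 1" by simp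
    also have "\<dots> \<le> \<alpha> * e" using \<open>0 < e\<close> by (simp add: \<alpha>_def)
    finally have "(\<integral>z. g z * indicator (B N) z \<partial>Q) \<le> e" using \<alpha> by simp
    moreover have "integrable Q (\<lambda>z. g z * indicator (B N) z)"
      using ent_int \<alpha> by simp
    then have "(\<integral>\<^sup>+ z. ennreal (g z * indicator (B N) z) \<partial>Q) = ennreal (\<integral>z. g z * indicator (B N) z \<partial>Q)"
      using g0 by (intro nn_integral_eq_integral) auto
    ultimately show "(\<integral>\<^sup>+ z. ennreal (g z * indicator (B N) z) \<partial>Q) \<le> ennreal e"
      by (simp add: ennreal_leI)
  qed
qed

lemma KL_le_imp_P1tilde:
  fixes R :: "('dx::finite, 'dy::finite) pt measure"
  assumes R: "prob_space R" "sets R = sets borel"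
    and exp: "integrable R (\<lambda>z. exp (2 + norm (fst (snd z))))"
    and Q: "prob_space Q" "sets Q = sets borel" "KL Q R \<le> ereal a"
  shows "Q \<in> P1tilde"
proof -
  have [measurable_cong]: "sets R = sets borel" "sets Q = sets borel" by fact+
  have "integrable R (\<lambda>z. exp (dtilde z 0))"
    by (rule Bochner_Integration.integrable_bound[OF exp]) (auto intro!: AE_I2 dtilde_0_le)
  then have "integrable Q (\<lambda>z. dtilde z 0)"
    using R Q by (intro entropy_inequality(1)[of R Q a _ 0]) auto
  then have "(\<integral>\<^sup>+ z. ennreal (dtilde z 0) \<partial>Q) < \<infinity>"
    by (simp add: integrable_iff_bounded)
  then show ?thesis using Q by (simp add: P1tilde_def)
qed

text \<open>
  On an entropy ball, setwise convergence implies convergence in \<^const>\<open>W1tilde\<close>. Setwise convergence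
  handles the masses of finitely many cells, uniform integrability the rest of the space.
\<close>

lemma setwise_tendsto_W1tilde:
  fixes R :: "('dx::finite, 'dy::finite) pt measure"
  assumes R: "prob_space R" "sets R = sets borel"
    and exp: "\<And>\<alpha>. 0 < \<alpha> \<Longrightarrow> integrable R (\<lambda>z. exp (\<alpha> * (2 + norm (fst (snd z)))))"
    and Q: "\<And>n::nat. prob_space (Q n)" "\<And>n. sets (Q n) = sets borel" "\<And>n. KL (Q n) R \<le> ereal a"
    and q: "prob_space q" "sets q = sets borel" "KL q R \<le> ereal a"
    and lim: "\<And>A. A \<in> sets borel \<Longrightarrow> (\<lambda>n. measure (Q n) A) \<longlonglongrightarrow> measure q A"
    and "0 < e"
  shows "\<forall>\<^sub>F n in sequentially. W1tilde (Q n) q < e"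
proof -
  define \<delta> where "\<delta> = e / 8"
  have \<delta>: "0 < \<delta>" using \<open>0 < e\<close> by (simp add: \<delta>_def)
  obtain c0 :: "('dx, 'dy) pt \<Rightarrow> nat" and s0 where
    c0 [measurable]: "c0 \<in> borel \<rightarrow>\<^sub>M count_space UNIV" and s0: "\<And>z. dtilde z (s0 (c0 z)) \<le> \<delta>"
    using ex_small_cells[OF \<delta>] by blast
  have "{z. N \<le> c0 z} \<in> sets borel" for N
    using measurable_sets[OF c0, of "{N..}"] by (simp add: vimage_def)
  moreover have "\<forall>\<^sub>F N in sequentially. z \<notin> {z. N \<le> c0 z}" for z
    using eventually_gt_at_top[of "c0 z"] by eventually_elim simp
  ultimately obtain N where N: "\<And>P. prob_space P \<Longrightarrow> sets P = sets borel \<Longrightarrow> KL P R \<le> ereal a \<Longrightarrow>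
      (\<integral>\<^sup>+ z. ennreal ((2 + norm (fst (snd z))) * indicator {z. N \<le> c0 z} z) \<partial>P) \<le> ennreal \<delta>"
    using KL_le_uniformly_integrable[OF R exp, of "\<lambda>N. {z. N \<le> c0 z}" \<delta> a] \<delta> by blast
  \<comment> \<open>The cells from \<open>N\<close> on are merged into the cell \<open>0\<close>, whose reference point is the origin.\<close>
  define c where "c z = (if c0 z < N then Suc (c0 z) else 0)" for z
  define s where "s i = (case i of 0 \<Rightarrow> 0 | Suc i \<Rightarrow> s0 i)" for i
  have c: "c \<in> borel \<rightarrow>\<^sub>M count_space UNIV"
    using measurable_compose[OF c0, of "\<lambda>i. if i < N then Suc i else 0" "count_space UNIV"]
    by (simp add: c_def[abs_def])
  have c_le: "c z \<in> {..N}" for z by (auto simp: c_def)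
  have sc [measurable]: "(\<lambda>z. s (c z)) \<in> borel_measurable borel"
    by (rule measurable_compose[OF c]) simp
  have near: "(\<integral>\<^sup>+ z. ennreal (dtilde z (s (c z))) \<partial>P) \<le> ennreal (2 * \<delta>)"
    if P: "prob_space P" "sets P = sets borel" "KL P R \<le> ereal a" for P
  proof -
    have [measurable_cong]: "sets P = sets borel" by fact
    have "(\<integral>\<^sup>+ z. ennreal (dtilde z (s (c z))) \<partial>P)
      \<le> (\<integral>\<^sup>+ z. ennreal \<delta> + ennreal ((2 + norm (fst (snd z))) * indicator {z. N \<le> c0 z} z) \<partial>P)"
    proof (rule nn_integral_mono)
      fix z :: "('dx, 'dy) pt"
      have "dtilde z (s (c z)) \<le> \<delta> + (2 + norm (fst (snd z))) * indicator {z. N \<le> c0 z} z"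
        using s0[of z] dtilde_0_le[of z] \<delta> by (auto simp: c_def s_def indicator_def)
      then have "ennreal (dtilde z (s (c z)))
          \<le> ennreal (\<delta> + (2 + norm (fst (snd z))) * indicator {z. N \<le> c0 z} z)"
        by (rule ennreal_leI)
      also have "\<dots> = ennreal \<delta> + ennreal ((2 + norm (fst (snd z))) * indicator {z. N \<le> c0 z} z)"
        using \<delta> by (intro ennreal_plus) auto
      finally show "ennreal (dtilde z (s (c z)))
          \<le> ennreal \<delta> + ennreal ((2 + norm (fst (snd z))) * indicator {z. N \<le> c0 z} z)" .
    qed
    also have "\<dots> = ennreal \<delta> + (\<integral>\<^sup>+ z. ennreal ((2 + norm (fst (snd z))) * indicator {z. N \<le> c0 z} z) \<partial>P)"
      using P by (subst nn_integral_add) (auto simp: prob_space.emeasure_space_1)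
    also have "\<dots> \<le> ennreal \<delta> + ennreal \<delta>"
      by (intro add_left_mono N P)
    finally show ?thesis
      using \<delta> by (simp add: ennreal_plus[symmetric] del: ennreal_plus)
  qed
  define D where "D = Max ((\<lambda>(i, j). dtilde (s i) (s j)) ` ({..N} \<times> {..N}))"
  have D: "dtilde (s i) (s j) \<le> D" if "i \<in> {..N}" "j \<in> {..N}" for i j
    unfolding D_def using that by (intro Max_ge) auto
  have D0: "0 \<le> D" using D[of 0 0] by simp
  define m where "m n i = min (measure (Q n) {z. c z = i}) (measure q {z. c z = i})" for n i
  have cell: "{z. c z = i} \<in> sets borel" for i
    using measurable_sets[OF c, of "{i}"] by (simp add: vimage_def)
  have "(\<lambda>n. D * (1 - (\<Sum>i\<le>N. m n i))) \<longlonglongrightarrow>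
      D * (1 - (\<Sum>i\<le>N. min (measure q {z. c z = i}) (measure q {z. c z = i})))"
    unfolding m_def by (intro tendsto_intros lim cell)
  also have "(\<Sum>i\<le>N. min (measure q {z. c z = i}) (measure q {z. c z = i})) = 1"
  proof -
    interpret q: prob_space q by fact
    have [measurable_cong]: "sets q = sets borel" by fact
    have "has_bochner_integral q (\<lambda>z. 1) (\<Sum>i\<le>N. 1 * measure q {z \<in> space q. c z = i})"
      using c c_le by (intro has_bochner_integral_finite_valued q.finite_measure_axioms) auto
    then show ?thesis
      using sets_eq_imp_space_eq[OF q(2)] q.prob_space by (simp add: has_bochner_integral_iff)
  qed
  finally have "(\<lambda>n. D * (1 - (\<Sum>i\<le>N. m n i))) \<longlonglongrightarrow> 0" by simp
  then have "\<forall>\<^sub>F n in sequentially. D * (1 - (\<Sum>i\<le>N. m n i)) < e / 4"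
    using \<open>0 < e\<close> by (intro order_tendstoD(2)) auto
  then show ?thesis
  proof eventually_elim
    case (elim n)
    have "transport_cost (Q n) q \<le> (\<integral>\<^sup>+ z. ennreal (dtilde z (s (c z))) \<partial>Q n)
        + (\<integral>\<^sup>+ z. ennreal (dtilde z (s (c z))) \<partial>q) + ennreal (D * (1 - (\<Sum>i\<le>N. m n i)))"
      unfolding m_def using c_le D D0
      by (intro transport_cost_finite_cells Q q c) auto
    also have "\<dots> \<le> ennreal (2 * \<delta>) + ennreal (2 * \<delta>) + ennreal (e / 4)"
      using elim by (intro add_mono near Q q ennreal_leI) auto
    also have "\<dots> = ennreal (3 * e / 4)"
      using \<open>0 < e\<close> by (simp add: \<delta>_def ennreal_plus[symmetric] del: ennreal_plus)
    finally have "W1tilde (Q n) q \<le> 3 * e / 4"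
      unfolding W1tilde_eq using \<open>0 < e\<close> by (intro enn2real_leI) auto
    then show "W1tilde (Q n) q < e" using \<open>0 < e\<close> by simp
  qed
qed

theorem KL_sublevel_compactin:
  fixes R :: "('dx::finite, 'dy::finite) pt measure"
  assumes R: "prob_space R" "sets R = sets borel"
    and exp: "\<And>\<alpha>. 0 < \<alpha> \<Longrightarrow> integrable R (\<lambda>z. exp (\<alpha> * (2 + norm (fst (snd z)))))"
  shows "compactin W1tilde_topology {Q \<in> P1tilde. KL Q R \<le> ereal a}"
  unfolding Metric_space.compactin_sequentially[OF Metric_space_W1tilde]
proof (intro conjI allI impI)
  fix Q :: "nat \<Rightarrow> ('dx, 'dy) pt measure"
  assume "range Q \<subseteq> {Q \<in> P1tilde. KL Q R \<le> ereal a}"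
  then have P1: "Q n \<in> P1tilde" and Q: "prob_space (Q n)" "sets (Q n) = sets borel" "KL (Q n) R \<le> ereal a" for n
    by (auto simp: P1tilde_def)
  have uac: "\<exists>d>0. \<forall>n. \<forall>A\<in>sets R. measure R A < d \<longrightarrow> measure (Q n) A < e" if e: "0 < e" for e
  proof -
    obtain d where "0 < d" and d: "\<And>P A. prob_space P \<Longrightarrow> sets P = sets R \<Longrightarrow> KL P R \<le> ereal a \<Longrightarrow>
        A \<in> sets R \<Longrightarrow> measure R A < d \<Longrightarrow> measure P A < e"
      using KL_le_uniformly_absolutely_continuous[OF R(1) e, of a] by blast
    then show ?thesis using Q R(2) by auto
  qed
  obtain r q where r: "strict_mono r" and q: "prob_space q" "sets q = sets borel"
    and lim: "\<And>A. A \<in> sets borel \<Longrightarrow> (\<lambda>n. measure (Q (r n)) A) \<longlonglongrightarrow> measure q A"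
    using setwise_convergent_subsequence[OF prob_space.finite_measure[OF R(1)] R(2) Q(1,2) uac]
    by metis
  have KL_q: "KL q R \<le> ereal a"
    by (rule KL_le_setwise_limit[where Q = "\<lambda>n. Q (r n)"]) (use R Q q lim in auto)
  have q_P1: "q \<in> P1tilde"
    using KL_le_imp_P1tilde[OF R _ q KL_q] exp[of 1] by simp
  have "\<forall>\<^sub>F n in sequentially. W1tilde (Q (r n)) q < e" if "0 < e" for e
    by (rule setwise_tendsto_W1tilde[OF R exp Q(1-3) q KL_q lim that])
  then have "limitin W1tilde_topology (Q \<circ> r) q sequentially"
    using q_P1 P1 by (simp add: Metric_space.limitin_metric[OF Metric_space_W1tilde])
  then show "\<exists>l r. l \<in> {Q \<in> P1tilde. KL Q R \<le> ereal a} \<and> strict_mono r \<and>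
      limitin W1tilde_topology (Q \<circ> r) l sequentially"
    using q_P1 KL_q r by blast
qed auto

section \<open>The Gibbs measure\<close>

text \<open>
  The Gibbs density is at most \<open>1 / gibbs_mass\<close>, hence integrability with respect to \<open>\<nu>\<close> carries
  over to the Gibbs measure.
\<close>

lemma gibbs_measure_properties:
  fixes \<mu> :: "(real ^ 'dy) measure" and \<nu> :: "((real ^ 'dx) \<times> (real ^ 'dy)) measure"
  assumes \<mu>: "prob_space \<mu>" "sets \<mu> = sets borel" and \<nu>: "prob_space \<nu>" "sets \<nu> = sets borel" and "\<epsilon> > 0"
  shows "prob_space (gibbs_measure \<epsilon> \<mu> \<nu>)"
    and "sets (gibbs_measure \<epsilon> \<mu> \<nu>) = sets borel"
    and "h \<in> borel_measurable borel \<Longrightarrow> integrable \<nu> h \<Longrightarrow>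
      integrable (gibbs_measure \<epsilon> \<mu> \<nu>) (\<lambda>z. h (snd z) :: real)"
proof -
  interpret \<mu>: prob_space \<mu> by fact
  interpret \<nu>: prob_space \<nu> by fact
  interpret pair_prob_space \<mu> \<nu> ..
  have [measurable_cong]: "sets \<mu> = sets borel" "sets \<nu> = sets (borel \<Otimes>\<^sub>M borel)"
    by (rule \<mu>) (subst borel_prod, rule \<nu>)
  define G where "G w = exp (- cost (fst w) (snd (snd w)) / \<epsilon>)"
    for w :: "('dx, 'dy) pt"
  define Z where "Z = gibbs_mass \<epsilon> \<mu> \<nu>"
  have [measurable]: "G \<in> borel_measurable (\<mu> \<Otimes>\<^sub>M \<nu>)"
    unfolding G_def cost_def by measurable
  have G: "0 < G w" "G w \<le> 1" for w
    using \<open>\<epsilon> > 0\<close> by (auto simp: G_def cost_def)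
  have G_int: "integrable (\<mu> \<Otimes>\<^sub>M \<nu>) G"
    using G by (intro integrable_const_bound[of _ 1]) (auto simp: abs_of_pos)
  have Z_eq: "Z = (\<integral>w. G w \<partial>(\<mu> \<Otimes>\<^sub>M \<nu>))"
    by (simp add: Z_def gibbs_mass_def G_def case_prod_unfold)
  have "(\<integral>w. 0 \<partial>(\<mu> \<Otimes>\<^sub>M \<nu>)) < Z"
    unfolding Z_eq by (rule integral_less_AE_space) (use G G_int emeasure_space_1 in auto)
  then have Z: "0 < Z" by simp
  have gibbs: "gibbs_measure \<epsilon> \<mu> \<nu> = density (\<mu> \<Otimes>\<^sub>M \<nu>) (\<lambda>w. ennreal (inverse Z * G w))"
    by (simp add: gibbs_measure_def Z_def G_def case_prod_unfold)
  have "(\<integral>\<^sup>+ w. ennreal (inverse Z * G w) \<partial>(\<mu> \<Otimes>\<^sub>M \<nu>)) = ennreal (\<integral>w. inverse Z * G w \<partial>(\<mu> \<Otimes>\<^sub>M \<nu>))"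
    using G G_int Z by (intro nn_integral_eq_integral) (auto simp: less_imp_le)
  also have "\<dots> = 1" using Z by (simp add: Z_eq[symmetric])
  finally show "prob_space (gibbs_measure \<epsilon> \<mu> \<nu>)"
    by (intro prob_spaceI) (simp add: gibbs emeasure_density cong: nn_integral_cong)
  have "sets (\<mu> \<Otimes>\<^sub>M \<nu>) = sets (borel \<Otimes>\<^sub>M borel)"
    using \<mu> \<nu> by (intro sets_pair_measure_cong) auto
  then show "sets (gibbs_measure \<epsilon> \<mu> \<nu>) = sets borel"
    unfolding gibbs sets_density by (subst (asm) borel_prod)
  assume h_meas: "h \<in> borel_measurable borel" and h: "integrable \<nu> h"
  then have [measurable]: "h \<in> borel_measurable \<nu>" by auto
  have "(\<integral>\<^sup>+ w. ennreal (norm (h (snd w))) \<partial>(\<mu> \<Otimes>\<^sub>M \<nu>)) = (\<integral>\<^sup>+ v. ennreal (norm (h v)) \<partial>\<nu>)"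
    by (subst nn_integral_snd[symmetric]) (auto simp: \<mu>.emeasure_space_1)
  then have "integrable (\<mu> \<Otimes>\<^sub>M \<nu>) (\<lambda>w. h (snd w))"
    using h by (simp add: integrable_iff_bounded)
  then have bound: "integrable (\<mu> \<Otimes>\<^sub>M \<nu>) (\<lambda>w. inverse Z * h (snd w))"
    by simp
  have "integrable (\<mu> \<Otimes>\<^sub>M \<nu>) (\<lambda>w. inverse Z * G w * h (snd w))"
  proof (rule Bochner_Integration.integrable_bound[OF bound])
    show "AE w in \<mu> \<Otimes>\<^sub>M \<nu>. norm (inverse Z * G w * h (snd w)) \<le> norm (inverse Z * h (snd w))"
    proof (rule AE_I2)
      fix w
      have "G w * \<bar>h (snd w)\<bar> \<le> 1 * \<bar>h (snd w)\<bar>"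
        using G[of w] by (intro mult_right_mono) auto
      then show "norm (inverse Z * G w * h (snd w)) \<le> norm (inverse Z * h (snd w))"
        using G[of w] Z by (simp add: abs_mult mult.assoc mult_left_mono)
    qed
  qed measurable
  then show "integrable (gibbs_measure \<epsilon> \<mu> \<nu>) (\<lambda>z. h (snd z))"
    unfolding gibbs using G Z
    by (subst integrable_real_density) (auto simp: less_imp_le intro!: AE_I2)
qed

theorem lemma2p1:
  fixes M :: "'w measure"
    and X :: "'w \<Rightarrow> real ^ 'dx" and Y :: "'w \<Rightarrow> real ^ 'dy"
    and \<nu> :: "((real ^ 'dx) \<times> (real ^ 'dy)) measure"
    and \<mu> :: "(real ^ 'dy) measure"
    and \<epsilon> :: real
  assumes "prob_space M"
    and "X \<in> borel_measurable M" and "Y \<in> borel_measurable M"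
    and "\<nu> = distr M borel (\<lambda>\<omega>. (X \<omega>, Y \<omega>))"
    and "integrable M (\<lambda>\<omega>. (norm (X \<omega>))\<^sup>2 + (norm (Y \<omega>))\<^sup>2)"
    and "(\<integral>\<omega>. X \<omega> \<partial>M) = 0"
    and "prob_space \<mu>" and "sets \<mu> = sets borel"
    and "integrable \<mu> (\<lambda>u. (norm u)\<^sup>2)"
    and "\<epsilon> > 0"
    and "\<forall>\<alpha>'>0. integrable M (\<lambda>\<omega>. exp (\<alpha>' * norm (X \<omega>)))"
  shows "\<forall>a::real. 0 < a \<longrightarrow>
    compactin W1tilde_topology {Q \<in> P1tilde. KL Q (gibbs_measure \<epsilon> \<mu> \<nu>) \<le> ereal a}"
proof (intro allI impI KL_sublevel_compactin)
  have [measurable]: "X \<in> borel_measurable M" "Y \<in> borel_measurable M" by fact+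
  have \<nu>: "prob_space \<nu>" "sets \<nu> = sets borel"
    using assms(1) unfolding assms(4) by (auto intro!: prob_space.prob_space_distr)
  note gibbs = gibbs_measure_properties[OF assms(7,8) \<nu> assms(10)]
  show "prob_space (gibbs_measure \<epsilon> \<mu> \<nu>)" "sets (gibbs_measure \<epsilon> \<mu> \<nu>) = sets borel"
    by (fact gibbs)+
  fix \<alpha> :: real assume \<alpha>: "0 < \<alpha>"
  define h where "h v = exp (\<alpha> * (2 + norm (fst v)))" for v :: "(real ^ 'dx) \<times> (real ^ 'dy)"
  have h: "h \<in> borel_measurable borel"
    unfolding h_def by measurable
  have "integrable M (\<lambda>\<omega>. exp (2 * \<alpha>) * exp (\<alpha> * norm (X \<omega>)))"
    using assms(11) \<alpha> by simp
  then have "integrable M (\<lambda>\<omega>. h (X \<omega>, Y \<omega>))"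
    by (simp add: h_def distrib_left exp_add mult.commute)
  then have "integrable \<nu> h"
    unfolding assms(4) using h by (subst integrable_distr_eq) auto
  then show "integrable (gibbs_measure \<epsilon> \<mu> \<nu>) (\<lambda>z. exp (\<alpha> * (2 + norm (fst (snd z)))))"
    using gibbs(3)[OF h] by (simp add: h_def)
qed

end
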